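(* Let $\mu$ be a finite positive Borel measure on $\mathbb{T}$ and let $E\subset\mathbb{T}$ be a closed set of Lebesgue measure zero. Suppose that $\rho_{\mu,E}(t)=O(t^\alpha)$ as $t\to0^+$, with $1\le\alpha<2$. If $$\int_0^\pi\frac{dt}{t^{\alpha-1}|E_t|}=+\infty,$$ then $c_\mu(E)=0$.
   Context: $\mathbb{T}$ is the unit circle; $L^2(\mathbb{T})$ is taken with respect to $dt/2\pi$. For $f\in L^2(\mathbb{T})$ put $$\mathcal{D}_\mu(f)=\int_{\mathbb{T}}\left(\int_{\mathbb{T}}\frac{|f(e^{it})-f(\xi)|^2}{|e^{it}-\xi|^2}\frac{dt}{2\pi}\right)d\mu(\xi),$$ where $f(\xi)$ is the non-tangential limit at $\xi$ of the Poisson integral of $f$ (the inner integral is $+\infty$ where this limit does not exist), and $\mathcal{D}^h(\mu)=\{f\in L^2(\mathbb{T}):\|f\|_\mu^2:=\|f\|_{L^2(\mathbb{T})}^2+\mathcal{D}_\mu(f)<\infty\}$. For $U\subset\mathbb{T}$ open, $c_\mu(U)=\inf\{\|u\|_\mu^2: u\in\mathcal{D}^h(\mu),\ u\ge0,\ u\ge1\text{ a.e. on }U\}$; for any $F\subset\mathbb{T}$, $c_\mu(F)=\inf\{c_\mu(U):U\text{ open},\ F\subset U\}$. $\rho_{\mu,E}(t)=\sup\{\mu(\zeta e^{-it},\zeta e^{it}):\zeta\in E\}$, where $(\zeta e^{-it},\zeta e^{it})=\{\zeta e^{i\theta}:|\theta|<t\}$. $E_t=\{\zeta\in\mathbb{T}:d(\zeta,E)\le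 t\}$, with $d$ the arc-length distance, and $|E_t|$ is its arc-length Lebesgue measure. *)

theory Defs
  imports "HOL-Analysis.Analysis" "HOL-Library.Landau_Symbols"
begin

abbreviation unit_circle :: "complex set"
  where "unit_circle \<equiv> sphere 0 1"

abbreviation circle_borel :: "complex measure"
  where "circle_borel \<equiv> restrict_space borel unit_circle"

definition arc_length :: "complex measure"
  where "arc_length = distr (restrict_space lborel {0..<2 * pi}) circle_borel cis"

text \<open>The normalised measure dt/2pi.\<close>

definition circle_measure :: "complex measure"
  where "circle_measure = density arc_length (\<lambda>_. ennreal (1 / (2 * pi)))"

text \<open>Elements of the L2 space are represented by Borel functions. All quantities below depend only
  on their almost-everywhere class; in particular the boundary value of a function is taken from
  its Poisson integral and not from its pointwise values.\<close>

definition L2_circle :: "(complex \<Rightarrow> complex) set"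
  where "L2_circle =
    {f \<in> borel_measurable circle_measure.
       (\<integral>\<^sup>+z. ennreal ((cmod (f z))\<^sup>2) \<partial>circle_measure) < \<infinity>}"

definition poisson_integral :: "(complex \<Rightarrow> complex) \<Rightarrow> complex \<Rightarrow> complex"
  where "poisson_integral f w =
    (\<integral>z. complex_of_real ((1 - (cmod w)\<^sup>2) / (cmod (z - w))\<^sup>2) * f z \<partial>circle_measure)"

definition stolz_region :: "real \<Rightarrow> complex \<Rightarrow> complex set"
  where "stolz_region C \<xi> = {w \<in> ball 0 1. cmod (w - \<xi>) < C * (1 - cmod w)}"

definition has_nontangential_limit :: "(complex \<Rightarrow> complex) \<Rightarrow> complex \<Rightarrow> complex \<Rightarrow> bool"
  where "has_nontangential_limit F \<xi> L \<longleftrightarrow>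
    (\<forall>C>1. (F \<longlongrightarrow> L) (at \<xi> within stolz_region C \<xi>))"

definition boundary_value :: "(complex \<Rightarrow> complex) \<Rightarrow> complex \<Rightarrow> complex"
  where "boundary_value f \<xi> = (THE L. has_nontangential_limit (poisson_integral f) \<xi> L)"

definition local_dirichlet :: "(complex \<Rightarrow> complex) \<Rightarrow> complex \<Rightarrow> ennreal"
  where "local_dirichlet f \<xi> =
    (if \<exists>L. has_nontangential_limit (poisson_integral f) \<xi> L
     then \<integral>\<^sup>+z. ennreal ((cmod (f z - boundary_value f \<xi>))\<^sup>2 / (cmod (z - \<xi>))\<^sup>2) \<partial>circle_measure
     else \<infinity>)"

definition dirichlet_integral :: "complex measure \<Rightarrow> (complex \<Rightarrow> complex) \<Rightarrow> ennreal"
  where "dirichlet_integral \<mu> f = (\<integral>\<^sup>+\<xi>. local_dirichlet f \<xi> \<partial>\<mu>)"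

definition dirichlet_norm_sq :: "complex measure \<Rightarrow> (complex \<Rightarrow> complex) \<Rightarrow> ennreal"
  where "dirichlet_norm_sq \<mu> f =
    (\<integral>\<^sup>+z. ennreal ((cmod (f z))\<^sup>2) \<partial>circle_measure) + dirichlet_integral \<mu> f"

definition harmonic_dirichlet_space :: "complex measure \<Rightarrow> (complex \<Rightarrow> complex) set"
  where "harmonic_dirichlet_space \<mu> = {f \<in> L2_circle. dirichlet_norm_sq \<mu> f < \<infinity>}"

definition open_capacity :: "complex measure \<Rightarrow> complex set \<Rightarrow> ennreal"
  where "open_capacity \<mu> U =
    Inf {dirichlet_norm_sq \<mu> u | u. u \<in> harmonic_dirichlet_space \<mu> \<and>
           (AE z in circle_measure. u z \<in> \<real> \<and> 0 \<le> Re (u z)) \<and>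
           (AE z in circle_measure. z \<in> U \<longrightarrow> 1 \<le> Re (u z))}"

definition capacity :: "complex measure \<Rightarrow> complex set \<Rightarrow> ennreal"
  where "capacity \<mu> F =
    Inf {open_capacity \<mu> U | U. openin (top_of_set unit_circle) U \<and> F \<subseteq> U}"

definition open_arc :: "complex \<Rightarrow> real \<Rightarrow> complex set"
  where "open_arc \<zeta> t = {\<zeta> * cis \<theta> | \<theta>. \<bar>\<theta>\<bar> < t}"

text \<open>Suprema and infima are taken in the extended nonnegative reals, where those over the empty
  set are 0 and infinity respectively, so that the empty set needs no special treatment.\<close>

definition arc_modulus :: "complex measure \<Rightarrow> complex set \<Rightarrow> real \<Rightarrow> ennreal"
  where "arc_modulus \<mu> E t = (SUP \<zeta>\<in>E. emeasure \<mu> (open_arc \<zeta> t))"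

definition arc_dist :: "complex \<Rightarrow> complex \<Rightarrow> real"
  where "arc_dist z w = \<bar>Arg (w / z)\<bar>"

definition arc_nbhd :: "complex set \<Rightarrow> real \<Rightarrow> complex set"
  where "arc_nbhd E t = {\<zeta> \<in> unit_circle. (INF w\<in>E. ennreal (arc_dist \<zeta> w)) \<le> ennreal t}"

end

theory Submission
  imports Defs "HOL-Complex_Analysis.Cauchy_Integral_Formula"
begin

text \<open>Write h_n = 2^{-n}, let K_t be the set of points of the circle at (chordal) distance at most t
  from E, and put T = 2^{\<alpha> - 2} < 1 and e_n = |K_{2 h_n}|. The test functions are
  u = \<Sum> a_n u_n over N \<le> n < M, where u_n is a piecewise linear function of the distance to E that
  drops from 1 to 0 between h_n / 2 and h_n. If m \<ge> n then
  |u_n(z) - u_n(\<xi>)| |u_m(z) - u_m(\<xi>)| / |z - \<xi>|^2 is at most a constant times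
  1 / (|z - \<xi>|^2 + h_n^2) and vanishes unless z or \<xi> lies in K_{h_m}. Since \<mu> gives mass
  O(r^\<alpha>) to discs of radius r centred on E, and hence \<mu>(K_t) = O(t^{\<alpha> - 1} |K_{2t}|), the mutual energy
  of u_n and u_m is O(e_m h_n^{\<alpha> - 2}) = O(e_m / T^n). The choice of a_n proportional to T^n / e_n with sum 1
  makes the energy of u at most a constant divided by \<Sum> T^n / e_n. The latter sum is a dyadic
  version of the integral in the hypothesis, so it is unbounded in M, while the L2 norm of u is
  controlled by |K_{h_N}|, which tends to |E| = 0.\<close>

section \<open>Arc length on the circle\<close>

text \<open>A single u_n is not enough: the bound for its energy is of order e_n / T^n, and
  divergence of the sum of T^n / e_n allows these quotients to stay bounded below. The weights are
  the ones that minimise the diagonal part, the sum of a_n^2 e_n / T^n, when the a_n add up to 1.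
  The off-diagonal part costs only a constant factor more: in a_n a_m e_m / T^n with m >= n the
  product a_m e_m is proportional to T^m, so the sum over m is geometric and cancels 1 / T^n. The
  condition \<alpha> < 2 enters as T < 1, here and again in the dyadic shells that bound the kernel
  integrals; 1 <= \<alpha> makes powers with exponent \<alpha> - 1 monotone, so that a finer scale
  may be replaced by a coarser one. Boundary values are defined through Poisson integrals, so before
  any energy is estimated it has to be shown that a continuous function is its own boundary
  value.\<close>

lemma cmod_cis_minus_cis: "cmod (cis x - cis y) = 2 * \<bar>sin ((x - y) / 2)\<bar>"
proof -
  have "(cmod (cis x - cis y))\<^sup>2 = (cos x - cos y)\<^sup>2 + (sin x - sin y)\<^sup>2"
    by (simp add: cmod_power2)
  also have "\<dots> = ((cos x)\<^sup>2 + (sin x)\<^sup>2) + ((cos y)\<^sup>2 + (sin y)\<^sup>2)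
      - 2 * (cos x * cos y + sin x * sin y)"
    by (simp add: power2_eq_square algebra_simps)
  also have "\<dots> = 2 - 2 * cos (x - y)"
    by (simp add: cos_diff)
  also have "\<dots> = (2 * \<bar>sin ((x - y) / 2)\<bar>)\<^sup>2"
    using cos_double_sin[of "(x - y) / 2"] by (simp add: power_mult_distrib diff_divide_distrib)
  finally show ?thesis
    by (subst (asm) power2_eq_iff_nonneg) auto
qed

text \<open>Concavity puts sin above its chord on [0, pi / 2], whose slope is 2 / pi; since pi < 4
  this exceeds 1 / 2. The weaker constant keeps pi out of the later comparisons of arcs with
  chords.\<close>

lemma half_le_sin:
  fixes x :: real
  assumes "0 \<le> x" "x \<le> pi / 2"
  shows "x / 2 \<le> sin x"
proof -
  have concave: "concave_on {0..pi/2} sin"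
  proof (rule f''_le0_imp_concave)
    show "convex {0..pi/2}" by simp
    show "(sin has_real_derivative cos x) (at x)" for x :: real
      by (rule DERIV_sin)
    show "(cos has_real_derivative - sin x) (at x)" for x :: real
      by (rule DERIV_cos)
    show "- sin x \<le> 0" if "x \<in> {0..pi/2}" for x :: real
      using that sin_ge_zero[of x] pi_ge_zero by auto
  qed
  define t where "t = x / (pi / 2)"
  have t: "0 \<le> t" "t \<le> 1"
    using assms pi_gt_zero by (auto simp: t_def field_simps)
  have "(1 - t) * sin 0 + t * sin (pi / 2) \<le> sin ((1 - t) *\<^sub>R 0 + t *\<^sub>R (pi / 2))"
    by (rule concave_onD[OF concave t]) auto
  then have "t \<le> sin x"
    by (simp add: t_def)
  moreover have "x \<le> 2 * t"
    using mult_left_mono[of pi 4 x] pi_less_4 assms(1) pi_gt_zero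
    by (simp add: t_def field_simps)
  ultimately show ?thesis by simp
qed

lemma chord_le_arc: "cmod (cis x - cis y) \<le> \<bar>x - y\<bar>"
  using abs_sin_x_le_abs_x[of "(x - y) / 2"] by (simp add: cmod_cis_minus_cis)

lemma arc_le_chord:
  assumes "\<bar>x - y\<bar> \<le> pi"
  shows "\<bar>x - y\<bar> \<le> 2 * cmod (cis x - cis y)"
proof -
  have "\<bar>x - y\<bar> / 2 / 2 \<le> sin (\<bar>x - y\<bar> / 2)"
    by (rule half_le_sin) (use assms in auto)
  also have "\<dots> \<le> \<bar>sin ((x - y) / 2)\<bar>"
  proof (cases "x \<le> y")
    case True
    then have "\<bar>x - y\<bar> = - (x - y)"
      by simp
    then have "\<bar>x - y\<bar> / 2 = - ((x - y) / 2)"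
      by (simp only: minus_divide_left)
    then have "sin (\<bar>x - y\<bar> / 2) = - sin ((x - y) / 2)"
      by (simp only: sin_minus)
    then show ?thesis by simp
  qed simp
  finally show ?thesis
    by (simp add: cmod_cis_minus_cis)
qed

lemma sets_arc_length: "sets arc_length = sets circle_borel"
  and space_arc_length: "space arc_length = unit_circle"
  by (auto simp: arc_length_def space_restrict_space)

lemma sets_circle_measure: "sets circle_measure = sets circle_borel"
  and space_circle_measure: "space circle_measure = unit_circle"
  by (auto simp: circle_measure_def sets_arc_length space_arc_length)

lemma measurable_circle_borel:
  assumes "f \<in> measurable borel N" "sets M = sets circle_borel"
  shows "f \<in> measurable M N"
  using measurable_restrict_space1[OF assms(1), of unit_circle]
  by (simp add: measurable_cong_sets[OF assms(2) refl])

lemma borel_measurable_cis: "cis \<in> borel_measurable borel"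
  by (intro borel_measurable_continuous_onI continuous_intros)

lemma measurable_cis: "cis \<in> measurable (restrict_space lborel A) circle_borel"
proof (rule measurable_restrict_space2)
  show "cis \<in> borel_measurable (restrict_space lborel A)"
    by (rule measurable_restrict_space1) (simp add: borel_measurable_cis)
qed auto

lemma nn_integral_arc_length:
  assumes "f \<in> borel_measurable circle_borel"
  shows "(\<integral>\<^sup>+z. f z \<partial>arc_length) = (\<integral>\<^sup>+t\<in>{0..<2 * pi}. f (cis t) \<partial>lborel)"
  unfolding arc_length_def
  using assms by (subst nn_integral_distr[OF measurable_cis])
    (simp_all add: nn_integral_restrict_space)

lemma emeasure_arc_length:
  assumes "A \<in> sets circle_borel"
  shows "emeasure arc_length A = emeasure lborel {t \<in> {0..<2 * pi}. cis t \<in> A}"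
proof -
  have "emeasure arc_length A
      = emeasure (restrict_space lborel {0..<2 * pi})
          (cis -` A \<inter> space (restrict_space lborel {0..<2 * pi}))"
    unfolding arc_length_def by (rule emeasure_distr[OF measurable_cis assms])
  also have "cis -` A \<inter> space (restrict_space lborel {0..<2 * pi})
      = {t \<in> {0..<2 * pi}. cis t \<in> A}"
    by (auto simp: space_restrict_space)
  also have "emeasure (restrict_space lborel {0..<2 * pi}) \<dots> = emeasure lborel \<dots>"
    by (rule emeasure_restrict_space) auto
  finally show ?thesis .
qed

lemma in_sets_circle_borel:
  assumes "A \<in> sets borel" "A \<subseteq> unit_circle"
  shows "A \<in> sets circle_borel"
  using assms by (auto simp: sets_restrict_space)

lemma emeasure_arc_length_space: "emeasure arc_length unit_circle = ennreal (2 * pi)"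
proof -
  have "{t \<in> {0..<2 * pi}. cis t \<in> unit_circle} = {0..<2 * pi}" by auto
  then show ?thesis
    by (simp add: emeasure_arc_length in_sets_circle_borel)
qed

lemma finite_measure_arc_length: "finite_measure arc_length"
  by standard (simp add: space_arc_length emeasure_arc_length_space)

lemma obtain_cis:
  assumes "z \<in> unit_circle"
  obtains t where "0 \<le> t" "t < 2 * pi" "z = cis t"
  using assms Arg2pi_ge_0[of z] Arg2pi_lt_2pi[of z] Arg2pi_eq[of z]
  by (metis cis_conv_exp mult_1 of_real_1 dist_0_norm mem_sphere)

lemma ball_circle_sets: "unit_circle \<inter> ball z r \<in> sets circle_borel"
  by (rule in_sets_circle_borel) auto

lemma emeasure_arc_length_ball_le:
  assumes "\<xi> \<in> unit_circle" "r > 0"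
  shows "emeasure arc_length (unit_circle \<inter> ball \<xi> r) \<le> ennreal (12 * r)"
proof -
  obtain s where s: "0 \<le> s" "s < 2 * pi" "\<xi> = cis s"
    using assms(1) by (rule obtain_cis)
  \<comment> \<open>The parameter runs over [0, 2 pi), so a disc near the point 1 can meet both ends
    of this interval. The translates of the centre by 2 pi catch the wrapped pieces; three intervals
    of length 4 r give the constant 12.\<close>
  define I where "I = (\<lambda>c. {c - 2 * r..c + 2 * r})"
  have "{t \<in> {0..<2 * pi}. cis t \<in> unit_circle \<inter> ball \<xi> r}
      \<subseteq> I s \<union> (I (s + 2 * pi) \<union> I (s - 2 * pi))"
  proof
    fix t assume "t \<in> {t \<in> {0..<2 * pi}. cis t \<in> unit_circle \<inter> ball \<xi> r}"
    then have t: "0 \<le> t" "t < 2 * pi" "cmod (cis t - cis s) < r"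
      by (auto simp: s dist_norm norm_minus_commute)
    have p: "cis (s + 2 * pi) = cis s" "cis (s - 2 * pi) = cis s"
      by (simp_all add: complex_eq_iff cos_diff sin_diff)
    consider "\<bar>t - s\<bar> \<le> pi" | "t - s > pi" | "t - s < - pi" by linarith
    then show "t \<in> I s \<union> (I (s + 2 * pi) \<union> I (s - 2 * pi))"
    proof cases
      case 1
      then show ?thesis using arc_le_chord[OF 1] t by (auto simp: I_def abs_if split: if_splits)
    next
      case 2
      then have "\<bar>t - (s + 2 * pi)\<bar> \<le> pi" using t s by auto
      from arc_le_chord[OF this] show ?thesis
        using t by (auto simp: p I_def abs_if split: if_splits)
    next
      case 3
      then have "\<bar>t - (s - 2 * pi)\<bar> \<le> pi" using t s by auto
      from arc_le_chord[OF this] show ?thesis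
        using t by (auto simp: p I_def abs_if split: if_splits)
    qed
  qed
  then have "emeasure arc_length (unit_circle \<inter> ball \<xi> r)
      \<le> emeasure lborel (I s \<union> (I (s + 2 * pi) \<union> I (s - 2 * pi)))"
    by (subst emeasure_arc_length[OF ball_circle_sets]) (rule emeasure_mono, auto simp: I_def)
  also have "\<dots> \<le> emeasure lborel (I s) + (emeasure lborel (I (s + 2 * pi))
      + emeasure lborel (I (s - 2 * pi)))"
    by (intro order.trans[OF emeasure_subadditive] add_left_mono emeasure_subadditive)
      (auto simp: I_def)
  also have "\<dots> = ennreal (12 * r)"
    using assms(2) by (simp add: I_def flip: ennreal_plus)
  finally show ?thesis .
qed

lemma emeasure_arc_length_ball_ge:
  assumes "\<xi> \<in> unit_circle" "0 < r" "r \<le> 1"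
  shows "ennreal r \<le> emeasure arc_length (unit_circle \<inter> ball \<xi> r)"
proof -
  obtain s where s: "0 \<le> s" "s < 2 * pi" "\<xi> = cis s"
    using assms(1) by (rule obtain_cis)
  \<comment> \<open>A one-sided interval of length r suffices. It points away from the nearer end of
    [0, 2 pi) and stays inside because r <= 1 < pi.\<close>
  define J where "J = (if s < pi then {s..<s + r} else {s - r<..s})"
  have "J \<subseteq> {t \<in> {0..<2 * pi}. cis t \<in> unit_circle \<inter> ball \<xi> r}"
  proof
    fix t assume t: "t \<in> J"
    have "cmod (cis t - cis s) < r"
      using chord_le_arc[of t s] t by (auto simp: J_def split: if_splits)
    moreover have "0 \<le> t" "t < 2 * pi"
      using t s assms(3) pi_gt3 by (auto simp: J_def split: if_splits)
    ultimately show "t \<in> {t \<in> {0..<2 * pi}. cis t \<in> unit_circle \<inter> ball \<xi> r}"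
      by (auto simp: s dist_norm norm_minus_commute)
  qed
  moreover have "{t \<in> {0..<2 * pi}. cis t \<in> unit_circle \<inter> ball \<xi> r} \<in> sets lborel"
  proof -
    have "cis -` ball \<xi> r \<inter> space borel \<in> sets borel"
      by (rule measurable_sets[OF borel_measurable_cis]) auto
    moreover have "{t \<in> {0..<2 * pi}. cis t \<in> unit_circle \<inter> ball \<xi> r}
        = {0..<2 * pi} \<inter> (cis -` ball \<xi> r \<inter> space borel)"
      by auto
    ultimately show ?thesis by simp
  qed
  ultimately have "emeasure lborel J
      \<le> emeasure lborel {t \<in> {0..<2 * pi}. cis t \<in> unit_circle \<inter> ball \<xi> r}"
    by (rule emeasure_mono)
  moreover have "emeasure lborel J = ennreal r"
    using assms(2) by (auto simp: J_def)
  ultimately show ?thesis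
    by (simp add: emeasure_arc_length[OF ball_circle_sets])
qed

section \<open>Boundary values of continuous functions\<close>

lemma nn_integral_circle_measure:
  assumes "f \<in> borel_measurable circle_borel"
  shows "(\<integral>\<^sup>+z. f z \<partial>circle_measure) = ennreal (1 / (2 * pi)) * (\<integral>\<^sup>+z. f z \<partial>arc_length)"
proof -
  have "f \<in> borel_measurable arc_length"
    using assms by (simp add: measurable_cong_sets[OF sets_arc_length refl])
  then show ?thesis
    unfolding circle_measure_def by (subst nn_integral_density) (auto simp: nn_integral_cmult)
qed

lemma circle_measure_le_arc_length:
  assumes "f \<in> borel_measurable circle_borel"
  shows "(\<integral>\<^sup>+z. f z \<partial>circle_measure) \<le> (\<integral>\<^sup>+z. f z \<partial>arc_length)"
proof -
  have "ennreal (1 / (2 * pi)) \<le> 1"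
    using pi_gt3 by (simp add: ennreal_le_1)
  then have "ennreal (1 / (2 * pi)) * (\<integral>\<^sup>+z. f z \<partial>arc_length) \<le> 1 * (\<integral>\<^sup>+z. f z \<partial>arc_length)"
    by (rule mult_right_mono) simp
  then show ?thesis
    by (simp add: nn_integral_circle_measure[OF assms])
qed

lemma emeasure_circle_measure_space: "emeasure circle_measure unit_circle = 1"
proof -
  have "emeasure circle_measure unit_circle = (\<integral>\<^sup>+z. 1 \<partial>circle_measure)"
    by (simp add: space_circle_measure)
  also have "\<dots> = ennreal (1 / (2 * pi)) * (\<integral>\<^sup>+z. 1 \<partial>arc_length)"
    by (rule nn_integral_circle_measure) simp
  also have "\<dots> = 1"
    by (simp add: space_arc_length emeasure_arc_length_space flip: ennreal_mult)
  finally show ?thesis .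
qed

lemma finite_measure_circle_measure: "finite_measure circle_measure"
  by standard (simp add: space_circle_measure emeasure_circle_measure_space)

lemma continuous_measurable_circle:
  fixes f :: "complex \<Rightarrow> 'b::topological_space"
  assumes "continuous_on unit_circle f" "sets M = sets circle_borel"
  shows "f \<in> borel_measurable M"
  using borel_measurable_continuous_on_restrict[OF assms(1)]
  by (simp add: measurable_cong_sets[OF assms(2) refl])

lemma continuous_integrable_circle:
  fixes f :: "complex \<Rightarrow> 'b::{banach,second_countable_topology}"
  assumes "continuous_on unit_circle f"
  shows "integrable circle_measure f"
proof -
  have "compact (f ` unit_circle)"
    using assms by (intro compact_continuous_image) auto
  then obtain B where "\<forall>z\<in>unit_circle. norm (f z) \<le> B"
    using compact_imp_bounded bounded_iff by (metis imageI)
  then show ?thesis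
    by (intro finite_measure.integrable_const_bound[OF finite_measure_circle_measure, of _ B]
        continuous_measurable_circle[OF assms sets_circle_measure] AE_I2)
      (auto simp: space_circle_measure)
qed

lemma integral_poisson_kernel:
  assumes w: "w \<in> ball 0 1"
  shows "(\<integral>z. (1 - (cmod w)\<^sup>2) / (cmod (z - w))\<^sup>2 \<partial>circle_measure) = 1"
proof -
  define k where "k = (\<lambda>z. (1 - (cmod w)\<^sup>2) / (cmod (z - w))\<^sup>2)"
  define g where "g = (\<lambda>z. of_real (1 - (cmod w)\<^sup>2) / (1 - cnj w * z))"
  have lt: "cmod w < 1" using w by simp
  have nz: "1 - cnj w * z \<noteq> 0" if "cmod z \<le> 1" for z
  proof
    assume "1 - cnj w * z = 0"
    then have "1 = cmod w * cmod z"
      by (metis complex_mod_cnj eq_iff_diff_eq_0 norm_mult norm_one)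
    also have "\<dots> \<le> cmod w * 1" using that by (intro mult_left_mono) auto
    finally show False using lt by simp
  qed
  have kernel: "g z / (z - w) * z = of_real (k z)" if "cmod z = 1" for z
  proof -
    have "z \<noteq> 0" using that by auto
    have zz: "z * cnj z = 1" using that by (simp flip: complex_norm_square)
    have "of_real ((cmod (z - w))\<^sup>2) = (z - w) * (cnj z - cnj w)"
      by (simp only: complex_norm_square complex_cnj_diff)
    moreover have "z * (cnj z - cnj w) = 1 - cnj w * z"
      using zz by (simp add: algebra_simps)
    ultimately have eq: "of_real ((cmod (z - w))\<^sup>2) * z = (z - w) * (1 - cnj w * z)"
      by (metis mult.assoc mult.commute)
    have "g z / (z - w) * z = of_real (1 - (cmod w)\<^sup>2) * z / ((z - w) * (1 - cnj w * z))"
      by (simp add: g_def mult.commute)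
    also have "\<dots> = of_real (1 - (cmod w)\<^sup>2) * z / (of_real ((cmod (z - w))\<^sup>2) * z)"
      by (simp only: eq)
    also have "\<dots> = of_real (k z)"
      using \<open>z \<noteq> 0\<close> by (simp add: k_def)
    finally show ?thesis .
  qed
  \<comment> \<open>On the circle the Poisson kernel is g(z) z / (z - w) with g holomorphic, so Cauchy's formula
    gives its mean value as g(w) = 1.\<close>
  have "((\<lambda>z. g z / (z - w)) has_contour_integral (2 * pi * \<i> * winding_number (circlepath 0 1) w * g w))
      (circlepath 0 1)"
  proof (rule Cauchy_integral_formula_convex_simple[of "cball 0 1"])
    show "g holomorphic_on cball 0 1"
      unfolding g_def using nz by (intro holomorphic_intros) auto
  qed (use w in auto)
  moreover have "winding_number (circlepath 0 1) w = 1"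
    using w by (intro winding_number_circlepath) simp
  moreover have "g w = 1"
  proof -
    have "1 - cnj w * w = of_real (1 - (cmod w)\<^sup>2)"
      using complex_norm_square[of w] by (simp add: mult.commute)
    then show ?thesis using nz[of w] lt by (simp add: g_def)
  qed
  ultimately have "((\<lambda>z. g z / (z - w)) has_contour_integral (2 * pi * \<i>)) (part_circlepath 0 1 0 (2 * pi))"
    by (simp add: circlepath_def)
  then have "((\<lambda>t. g (cis t) / (cis t - w) * \<i> * cis t) has_integral (2 * pi * \<i>)) {0..2 * pi}"
    by (simp add: has_contour_integral_part_circlepath_iff)
  moreover have "g (cis t) / (cis t - w) * \<i> * cis t = \<i> * of_real (k (cis t))" for t
    by (subst kernel[symmetric]) (simp_all add: mult_ac)
  ultimately have "((\<lambda>t. \<i> * of_real (k (cis t))) has_integral (2 * pi * \<i>)) {0..2 * pi}"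
    by simp
  \<comment> \<open>The derivative of the parametrisation contributes the factor
    \<open>\<i>\<close>; taking imaginary parts removes it and leaves a real integral.\<close>
  from has_integral_Im[OF this] have hi: "((\<lambda>t. k (cis t)) has_integral (2 * pi)) {0..2 * pi}"
    by simp
  have k0: "0 \<le> k z" for z
    using lt by (auto simp: k_def power_le_one)
  have ck: "continuous_on unit_circle k"
    unfolding k_def using lt by (intro continuous_intros) auto
  have ke: "(\<lambda>z. ennreal (k z)) \<in> borel_measurable circle_borel"
    using continuous_measurable_circle[OF ck refl] by measurable
  have "(\<integral>\<^sup>+z. ennreal (k z) \<partial>circle_measure)
      = ennreal (1 / (2 * pi)) * (\<integral>\<^sup>+t\<in>{0..<2 * pi}. ennreal (k (cis t)) \<partial>lborel)"
    using ke by (simp add: nn_integral_circle_measure nn_integral_arc_length)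
  also have "(\<integral>\<^sup>+t\<in>{0..<2 * pi}. ennreal (k (cis t)) \<partial>lborel)
      = (\<integral>\<^sup>+t\<in>{0..2 * pi}. ennreal (k (cis t)) \<partial>lborel)"
    by (rule nn_integral_cong_AE, rule AE_mp[OF AE_lborel_singleton[of "2 * pi"]])
      (auto intro!: AE_I2 simp: indicator_def)
  also have "\<dots> = ennreal (2 * pi)"
    using k0 hi by (rule nn_integral_has_integral_lebesgue')
  also have "ennreal (1 / (2 * pi)) * ennreal (2 * pi) = 1"
    by (simp flip: ennreal_mult)
  finally show ?thesis
    using k0 continuous_integrable_circle[OF ck] unfolding k_def[symmetric]
    by (subst integral_eq_nn_integral) (auto intro: continuous_measurable_circle[OF ck sets_circle_measure])
qed

text \<open>The Poisson kernel is an approximate identity: it is nonnegative with mean 1, and away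
  from \<xi> it tends to 0 uniformly as w approaches \<xi>. The limit is taken over the whole disc,
  so every Stolz region inherits it.\<close>

lemma tendsto_poisson_integral:
  assumes f: "continuous_on unit_circle f" and \<xi>: "\<xi> \<in> unit_circle"
  shows "(poisson_integral f \<longlongrightarrow> f \<xi>) (at \<xi> within ball 0 1)"
proof (rule tendstoI)
  fix e :: real assume e: "e > 0"
  define P where "P = (\<lambda>w z. (1 - (cmod w)\<^sup>2) / (cmod (z - w))\<^sup>2)"
  have "compact (f ` unit_circle)"
    using f by (intro compact_continuous_image) auto
  then obtain B where B: "\<And>z. z \<in> unit_circle \<Longrightarrow> cmod (f z) \<le> B"
    using compact_imp_bounded bounded_iff by (metis imageI)
  have B0: "B \<ge> 0"
    using B[OF \<xi>] norm_ge_zero order_trans by blast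
  obtain d where d: "d > 0" "\<And>z. z \<in> unit_circle \<Longrightarrow> dist z \<xi> < d \<Longrightarrow> dist (f z) (f \<xi>) < e / 2"
    using f \<xi> e unfolding continuous_on_iff by (metis half_gt_zero)
  \<comment> \<open>This is the error from the points z at distance at least d from \<xi>: there
    f(z) differs from f(\<xi>) by at most 2 B, and |z - w| >= d / 2 bounds the kernel by 4 (1 -
    |w|^2) / d^2.\<close>
  have "((\<lambda>w. 8 * B * (1 - (cmod w)\<^sup>2) / d\<^sup>2) \<longlongrightarrow> 8 * B * (1 - (cmod \<xi>)\<^sup>2) / d\<^sup>2) (at \<xi> within ball 0 1)"
    using d(1) by (intro tendsto_intros) auto
  then have "eventually (\<lambda>w. 8 * B * (1 - (cmod w)\<^sup>2) / d\<^sup>2 < e / 2) (at \<xi> within ball 0 1)"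
    using \<xi> e by (intro order_tendstoD(2)[where y = "8 * B * (1 - (cmod \<xi>)\<^sup>2) / d\<^sup>2"]) auto
  moreover have "eventually (\<lambda>w. dist w \<xi> < d / 2) (at \<xi> within ball 0 1)"
    using d(1) by (auto simp: eventually_at intro!: exI[of _ "d / 2"])
  moreover have "eventually (\<lambda>w. w \<in> ball 0 1) (at \<xi> within ball 0 1)"
    by (auto simp: eventually_at_filter)
  ultimately show "eventually (\<lambda>w. dist (poisson_integral f w) (f \<xi>) < e) (at \<xi> within ball 0 1)"
  proof eventually_elim
    case (elim w)
    then have w: "w \<in> ball 0 1" "cmod w < 1" and wd: "dist w \<xi> < d / 2" by auto
    have P0: "0 \<le> P w z" for z
      using w by (auto simp: P_def power_le_one)
    have cP: "continuous_on unit_circle (P w)"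
      unfolding P_def using w by (intro continuous_intros) auto
    have int: "integrable circle_measure (\<lambda>z. complex_of_real (P w z) * f z)"
      "integrable circle_measure (\<lambda>z. complex_of_real (P w z) * f \<xi>)"
      "integrable circle_measure (P w)"
      "integrable circle_measure (\<lambda>z. e / 2 * P w z + 2 * B * (4 * (1 - (cmod w)\<^sup>2) / d\<^sup>2))"
      by (intro continuous_integrable_circle continuous_intros cP f)+
    have P1: "(\<integral>z. P w z \<partial>circle_measure) = 1"
      unfolding P_def by (rule integral_poisson_kernel[OF w(1)])
    have "f \<xi> = (\<integral>z. complex_of_real (P w z) * f \<xi> \<partial>circle_measure)"
      using P1 int(3) by simp
    then have "poisson_integral f w - f \<xi>
        = (\<integral>z. complex_of_real (P w z) * f z - complex_of_real (P w z) * f \<xi> \<partial>circle_measure)"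
      unfolding Bochner_Integration.integral_diff[OF int(1,2)]
      by (simp add: poisson_integral_def P_def)
    also have "\<dots> = (\<integral>z. complex_of_real (P w z) * (f z - f \<xi>) \<partial>circle_measure)"
      by (simp add: algebra_simps)
    also have "cmod \<dots> \<le> (\<integral>z. cmod (complex_of_real (P w z) * (f z - f \<xi>)) \<partial>circle_measure)"
      by (rule integral_norm_bound)
    \<comment> \<open>Adding the bounds for near and far points gives one majorant valid for every
      z, so the integral need not be split.\<close>
    also have "\<dots> \<le> (\<integral>z. e / 2 * P w z + 2 * B * (4 * (1 - (cmod w)\<^sup>2) / d\<^sup>2) \<partial>circle_measure)"
    proof (rule integral_mono)
      show "integrable circle_measure (\<lambda>z. cmod (complex_of_real (P w z) * (f z - f \<xi>)))"
        by (intro continuous_integrable_circle continuous_intros cP f)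
      fix z assume "z \<in> space circle_measure"
      then have z: "z \<in> unit_circle" by (simp add: space_circle_measure)
      have r0: "0 \<le> 2 * B * (4 * (1 - (cmod w)\<^sup>2) / d\<^sup>2)"
        using B0 w by (auto simp: power_le_one)
      show "cmod (complex_of_real (P w z) * (f z - f \<xi>))
          \<le> e / 2 * P w z + 2 * B * (4 * (1 - (cmod w)\<^sup>2) / d\<^sup>2)"
      proof (cases "dist z \<xi> < d")
        case True
        then have "cmod (f z - f \<xi>) \<le> e / 2"
          using d(2)[OF z] by (simp add: dist_norm less_imp_le)
        from mult_left_mono[OF this P0[of z]] show ?thesis
          using r0 P0[of z] by (simp add: norm_mult mult.commute)
      next
        case False
        then have "d / 2 \<le> cmod (z - w)"
          using wd dist_triangle[of z \<xi> w] by (simp add: dist_norm)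
        moreover from this have "0 < cmod (z - w)" using d(1) by linarith
        ultimately have "(d / 2)\<^sup>2 \<le> (cmod (z - w))\<^sup>2"
          using d(1) by (intro power_mono) auto
        then have "P w z \<le> (1 - (cmod w)\<^sup>2) / (d / 2)\<^sup>2"
          unfolding P_def using d(1) w \<open>0 < cmod (z - w)\<close>
          by (intro divide_left_mono mult_pos_pos zero_less_power) (auto simp: power_le_one)
        also have "\<dots> = 4 * (1 - (cmod w)\<^sup>2) / d\<^sup>2"
          by (simp add: power_divide)
        finally have "P w z \<le> 4 * (1 - (cmod w)\<^sup>2) / d\<^sup>2" .
        moreover have "cmod (f z - f \<xi>) \<le> 2 * B"
          using B[OF z] B[OF \<xi>] norm_triangle_ineq4[of "f z" "f \<xi>"] by linarith
        ultimately have "P w z * cmod (f z - f \<xi>) \<le> 4 * (1 - (cmod w)\<^sup>2) / d\<^sup>2 * (2 * B)"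
          using P0[of z] by (intro mult_mono) auto
        moreover have "0 \<le> e / 2 * P w z" using e P0[of z] by simp
        ultimately show ?thesis
          using P0[of z] by (simp add: norm_mult mult_ac)
      qed
    qed (rule int)
    also have "\<dots> = e / 2 + 8 * B * (1 - (cmod w)\<^sup>2) / d\<^sup>2"
    proof -
      have "measure circle_measure (space circle_measure) = 1"
        by (simp add: measure_def space_circle_measure emeasure_circle_measure_space)
      then show ?thesis
        using int(3) P1 by (simp add: finite_measure.integrable_const[OF finite_measure_circle_measure])
    qed
    also have "\<dots> < e"
      using elim by simp
    finally show ?case by (simp add: dist_norm)
  qed
qed

text \<open>Limits along a Stolz region are unique only if \<xi> is an accumulation point of it.
  Radial points show this: for w = (1 - s) \<xi> the distance to \<xi> equals 1 - |w|, and C > 1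
  makes the defining inequality strict.\<close>

lemma stolz_region_nontrivial:
  assumes "\<xi> \<in> unit_circle" "C > 1"
  shows "at \<xi> within stolz_region C \<xi> \<noteq> bot"
proof -
  have "\<xi> islimpt stolz_region C \<xi>"
    unfolding islimpt_approachable
  proof (intro allI impI)
    fix e :: real assume e: "e > 0"
    define s where "s = min (1 / 2) (e / 2)"
    have s: "0 < s" "s < 1" "s < e" using e by (auto simp: s_def)
    define w where "w = of_real (1 - s) * \<xi>"
    have [simp]: "cmod \<xi> = 1" using assms by simp
    have "w - \<xi> = - (of_real s * \<xi>)"
      by (simp add: w_def algebra_simps)
    then have wx: "cmod (w - \<xi>) = s" using s by (simp add: norm_mult)
    have "cmod w = 1 - s" using s by (simp add: w_def norm_mult del: of_real_diff)
    then have "w \<in> stolz_region C \<xi>"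
      using s wx assms(2) by (simp add: stolz_region_def)
    then show "\<exists>x'\<in>stolz_region C \<xi>. x' \<noteq> \<xi> \<and> dist x' \<xi> < e"
      using wx s by (intro bexI[of _ w]) (auto simp: dist_norm)
  qed
  then show ?thesis by (simp add: trivial_limit_within)
qed

text \<open>Reduces the Poisson-based definitions to pointwise evaluation for continuous functions.
  The definite description in \<open>boundary_value\<close> also needs uniqueness, for which the
  single aperture C = 2 suffices.\<close>

lemma
  assumes "continuous_on unit_circle f" "\<xi> \<in> unit_circle"
  shows has_nontangential_limit_continuous: "has_nontangential_limit (poisson_integral f) \<xi> (f \<xi>)"
    and boundary_value_continuous: "boundary_value f \<xi> = f \<xi>"
proof -
  show lim: "has_nontangential_limit (poisson_integral f) \<xi> (f \<xi>)"
    unfolding has_nontangential_limit_def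
    by (intro allI impI tendsto_within_subset[OF tendsto_poisson_integral[OF assms]])
      (auto simp: stolz_region_def)
  show "boundary_value f \<xi> = f \<xi>"
    unfolding boundary_value_def
  proof (rule the_equality, rule lim)
    fix L assume "has_nontangential_limit (poisson_integral f) \<xi> L"
    then show "L = f \<xi>"
      using lim tendsto_unique[OF stolz_region_nontrivial[OF assms(2), of 2]]
      unfolding has_nontangential_limit_def by (metis one_less_numeral_iff semiring_norm(76))
  qed
qed

lemma local_dirichlet_continuous:
  assumes "continuous_on unit_circle f" "\<xi> \<in> unit_circle"
  shows "local_dirichlet f \<xi>
    = (\<integral>\<^sup>+z. ennreal ((cmod (f z - f \<xi>))\<^sup>2 / (cmod (z - \<xi>))\<^sup>2) \<partial>circle_measure)"
  using has_nontangential_limit_continuous[OF assms]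
  by (auto simp: local_dirichlet_def boundary_value_continuous[OF assms])

section \<open>Growth of the measure and kernel integrals\<close>

text \<open>Between the radii 2^(k-1) h and 2^k h the kernel is comparable to the inverse square of
  the radius, so growth of order \<gamma> turns the shells into a geometric series of ratio
  2^(\<gamma> - 2) < 1. On the innermost disc, of radius h, the kernel is at most 1 / h^2; hence
  only radii from h on enter, which is all that is known for a centre merely close to E. The lemma
  serves \<mu> with \<gamma> = \<alpha> and arc length with \<gamma> = 1.\<close>

lemma nn_integral_kernel_le:
  fixes \<nu> :: "complex measure"
  assumes sets: "sets \<nu> = sets circle_borel" and h: "h > 0" and A: "A \<ge> 0" and \<gamma>: "\<gamma> < 2"
    and growth: "\<And>r. h \<le> r \<Longrightarrow> emeasure \<nu> (unit_circle \<inter> ball z r) \<le> ennreal (A * r powr \<gamma>)"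
  shows "(\<integral>\<^sup>+\<xi>. ennreal (1 / ((dist z \<xi>)\<^sup>2 + h\<^sup>2)) \<partial>\<nu>)
    \<le> ennreal (4 * A * h powr (\<gamma> - 2) / (1 - 2 powr (\<gamma> - 2)))"
proof -
  define r where "r = (\<lambda>k::nat. 2 ^ k * h)"
  define T :: real where "T = 2 powr (\<gamma> - 2)"
  have T: "0 \<le> T" "T < 1"
    using \<gamma> powr_less_mono[of "\<gamma> - 2" 0 2] by (auto simp: T_def)
  have r: "r k > 0" "h \<le> r k" for k
    using h by (auto simp: r_def)
  have space: "space \<nu> = unit_circle"
    using sets_eq_imp_space_eq[OF sets] by (simp add: space_restrict_space)
  have pointwise: "ennreal (1 / ((dist z \<xi>)\<^sup>2 + h\<^sup>2))
      \<le> (\<Sum>k. ennreal (4 / (r k)\<^sup>2) * indicator (unit_circle \<inter> ball z (r k)) \<xi>)"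
    if \<xi>: "\<xi> \<in> unit_circle" for \<xi>
  proof -
    define q where "q = dist z \<xi>"
    obtain k where "q / h < 2 ^ k"
      using real_arch_pow[of 2 "q / h"] by auto
    then have ex: "q < r k"
      using h by (simp add: r_def field_simps)
    \<comment> \<open>The first disc containing \<xi>: its radius is h, or else the previous radius
      is at most q and \<open>r j\<close> is at most 2 q.\<close>
    define j where "j = (LEAST j. q < r j)"
    have j: "q < r j" unfolding j_def by (rule LeastI, rule ex)
    have "(r j)\<^sup>2 \<le> 4 * (q\<^sup>2 + h\<^sup>2)"
    proof (cases j)
      case 0
      then show ?thesis by (simp add: r_def)
    next
      case (Suc i)
      then have "r i \<le> q"
        using not_less_Least[of i "\<lambda>j. q < r j"] by (simp add: j_def)
      then have "(r j)\<^sup>2 \<le> (2 * q)\<^sup>2"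
        using r(1)[of i] r(1)[of j] Suc by (intro power_mono) (auto simp: r_def)
      also have "\<dots> \<le> 4 * (q\<^sup>2 + h\<^sup>2)"
        by (simp add: power_mult_distrib)
      finally show ?thesis .
    qed
    moreover have "0 < q\<^sup>2 + h\<^sup>2" using h by (simp add: add_nonneg_pos)
    ultimately have "1 / (q\<^sup>2 + h\<^sup>2) \<le> 4 / (r j)\<^sup>2"
      using r(1)[of j] by (simp add: field_simps)
    then have "ennreal (1 / (q\<^sup>2 + h\<^sup>2))
        \<le> ennreal (4 / (r j)\<^sup>2) * indicator (unit_circle \<inter> ball z (r j)) \<xi>"
      using j \<xi> by (simp add: q_def ennreal_leI)
    also have "\<dots> \<le> (\<Sum>k. ennreal (4 / (r k)\<^sup>2) * indicator (unit_circle \<inter> ball z (r k)) \<xi>)"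
      (is "?F j \<le> _")
    proof -
      define F where "F = ?F"
      have "F j \<le> suminf F"
        using sum_le_suminf[of F "{j}"] by (simp add: summableI)
      then show ?thesis by (simp add: F_def)
    qed
    finally show ?thesis by (simp add: q_def)
  qed
  have term_le: "ennreal (4 / (r k)\<^sup>2) * emeasure \<nu> (unit_circle \<inter> ball z (r k))
      \<le> ennreal (4 * A * h powr (\<gamma> - 2) * T ^ k)" for k
  proof -
    have "4 / (r k)\<^sup>2 * (A * r k powr \<gamma>) = 4 * A * (r k powr \<gamma> / r k powr 2)"
      using r(1)[of k] by (simp add: powr_numeral)
    also have "\<dots> = 4 * A * r k powr (\<gamma> - 2)"
      by (simp add: powr_diff)
    also have "r k powr (\<gamma> - 2) = h powr (\<gamma> - 2) * T ^ k"
    proof -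
      have "((2::real) ^ k) powr (\<gamma> - 2) = T ^ k"
        unfolding T_def by (simp add: powr_powr mult.commute flip: powr_realpow)
      then show ?thesis using h by (simp add: r_def powr_mult mult.commute)
    qed
    finally have eq: "4 / (r k)\<^sup>2 * (A * r k powr \<gamma>) = 4 * A * h powr (\<gamma> - 2) * T ^ k"
      by (simp add: mult_ac)
    have "ennreal (4 / (r k)\<^sup>2) * emeasure \<nu> (unit_circle \<inter> ball z (r k))
        \<le> ennreal (4 / (r k)\<^sup>2) * ennreal (A * r k powr \<gamma>)"
      using growth[OF r(2)] by (rule mult_left_mono) simp
    also have "\<dots> = ennreal (4 * A * h powr (\<gamma> - 2) * T ^ k)"
      unfolding eq[symmetric] using A by (intro ennreal_mult[symmetric]) auto
    finally show ?thesis .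
  qed
  have meas: "(\<lambda>\<xi>. ennreal (4 / (r k)\<^sup>2) * indicator (unit_circle \<inter> ball z (r k)) \<xi>)
      \<in> borel_measurable \<nu>" for k
    using ball_circle_sets[of z "r k"]
    by (intro borel_measurable_times_ennreal borel_measurable_indicator) (simp_all add: sets)
  have "(\<integral>\<^sup>+\<xi>. ennreal (1 / ((dist z \<xi>)\<^sup>2 + h\<^sup>2)) \<partial>\<nu>)
      \<le> (\<integral>\<^sup>+\<xi>. (\<Sum>k. ennreal (4 / (r k)\<^sup>2) * indicator (unit_circle \<inter> ball z (r k)) \<xi>) \<partial>\<nu>)"
    by (rule nn_integral_mono) (simp add: pointwise space)
  also have "\<dots> = (\<Sum>k. ennreal (4 / (r k)\<^sup>2) * emeasure \<nu> (unit_circle \<inter> ball z (r k)))"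
    using ball_circle_sets meas
    by (subst nn_integral_suminf) (simp_all add: nn_integral_cmult_indicator sets)
  also have "\<dots> \<le> (\<Sum>k. ennreal (4 * A * h powr (\<gamma> - 2) * T ^ k))"
    by (intro suminf_le term_le summableI)
  also have "\<dots> = ennreal (\<Sum>k. 4 * A * h powr (\<gamma> - 2) * T ^ k)"
    using A T by (intro suminf_ennreal2 summable_mult summable_geometric) auto
  also have "(\<Sum>k. 4 * A * h powr (\<gamma> - 2) * T ^ k) = 4 * A * h powr (\<gamma> - 2) * (1 / (1 - T))"
    using T by (simp add: suminf_mult summable_geometric suminf_geometric)
  finally show ?thesis by (simp add: T_def)
qed

text \<open>Chordal neighbourhoods are easier to handle than \<open>arc_nbhd\<close>, because
  \<open>infdist\<close> is 1-Lipschitz and attained on nonempty closed sets. For empty E it is 0 by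
  convention and this set is the whole circle when t >= 0, so the final proof treats the empty set
  apart.\<close>

definition circle_nbhd :: "complex set \<Rightarrow> real \<Rightarrow> complex set"
  where "circle_nbhd E t = {z \<in> unit_circle. infdist z E \<le> t}"

lemma closed_circle_nbhd: "closed (circle_nbhd E t)"
proof -
  have "circle_nbhd E t = unit_circle \<inter> {z. infdist z E \<le> t}"
    by (auto simp: circle_nbhd_def)
  then show ?thesis
    by (auto intro!: closed_Int closed_Collect_le continuous_intros)
qed

lemma circle_nbhd_sets: "circle_nbhd E t \<in> sets circle_borel"
  using closed_circle_nbhd[of E t] by (intro in_sets_circle_borel) (auto simp: circle_nbhd_def)

lemma circle_nbhd_mono: "s \<le> t \<Longrightarrow> circle_nbhd E s \<subseteq> circle_nbhd E t"
  by (auto simp: circle_nbhd_def)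

text \<open>Growth is given for centres in E only. If the nearest point of E lies within r of z, the
  disc of radius r about z sits in the doubled disc about that point; hence the condition s <= r and
  the factor 2.\<close>

lemma emeasure_ball_near:
  assumes sets: "sets \<mu> = sets circle_borel" and E: "closed E" "E \<noteq> {}"
    and growth: "\<And>\<zeta> r. \<zeta> \<in> E \<Longrightarrow> 0 < r \<Longrightarrow>
      emeasure \<mu> (unit_circle \<inter> ball \<zeta> r) \<le> ennreal (A * r powr \<alpha>)"
    and z: "z \<in> circle_nbhd E s" and r: "0 < r" "s \<le> r"
  shows "emeasure \<mu> (unit_circle \<inter> ball z r) \<le> ennreal (A * (2 * r) powr \<alpha>)"
proof -
  obtain \<zeta> where \<zeta>: "\<zeta> \<in> E" "infdist z E = dist z \<zeta>"
    using infdist_attains_inf[OF E] by blast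
  have "unit_circle \<inter> ball z r \<subseteq> unit_circle \<inter> ball \<zeta> (2 * r)"
  proof
    fix \<xi> assume \<xi>: "\<xi> \<in> unit_circle \<inter> ball z r"
    moreover have "dist z \<zeta> \<le> r" using z r \<zeta> by (simp add: circle_nbhd_def)
    ultimately show "\<xi> \<in> unit_circle \<inter> ball \<zeta> (2 * r)"
      using dist_triangle[of \<zeta> \<xi> z] by (auto simp: dist_commute)
  qed
  then have "emeasure \<mu> (unit_circle \<inter> ball z r) \<le> emeasure \<mu> (unit_circle \<inter> ball \<zeta> (2 * r))"
    by (rule emeasure_mono) (simp add: sets ball_circle_sets)
  also have "\<dots> \<le> ennreal (A * (2 * r) powr \<alpha>)"
    using r by (intro growth \<zeta>) auto
  finally show ?thesis .
qed

section \<open>Measurability and Tonelli for pairs of points on the circle\<close>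

lemma measurable_circle_pair:
  fixes f :: "complex \<times> complex \<Rightarrow> ennreal"
  assumes "f \<in> borel_measurable borel" "sets M = sets circle_borel" "sets N = sets circle_borel"
  shows "f \<in> borel_measurable (M \<Otimes>\<^sub>M N)"
proof -
  have id: "(\<lambda>x. x) \<in> measurable M borel" "(\<lambda>x. x) \<in> measurable N borel"
    by (rule measurable_circle_borel[OF _ assms(2)] measurable_circle_borel[OF _ assms(3)], simp)+
  have "(\<lambda>p. (fst p, snd p)) \<in> measurable (M \<Otimes>\<^sub>M N) (borel \<Otimes>\<^sub>M borel)"
    using measurable_compose[OF measurable_fst id(1)] measurable_compose[OF measurable_snd id(2)]
    by (rule measurable_Pair)
  then show ?thesis
    using measurable_compose[OF _ assms(1)] by (simp add: borel_prod)
qed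

lemma measurable_circle_pair_inner:
  fixes f :: "complex \<Rightarrow> complex \<Rightarrow> ennreal"
  assumes f: "(\<lambda>(x, y). f x y) \<in> borel_measurable borel" and M: "sets M = sets circle_borel"
  shows "(\<lambda>x. f x y) \<in> borel_measurable M" "(\<lambda>y. f x y) \<in> borel_measurable M"
proof -
  have "(\<lambda>x. (x, y)) \<in> borel_measurable borel" "(\<lambda>y. (x, y)) \<in> borel_measurable borel"
    by (auto intro!: borel_measurable_continuous_onI continuous_intros)
  from this[THEN measurable_compose, OF f]
  show "(\<lambda>x. f x y) \<in> borel_measurable M" "(\<lambda>y. f x y) \<in> borel_measurable M"
    by (auto intro: measurable_circle_borel[OF _ M])
qed

lemma measurable_circle_nn_integral:
  fixes f :: "complex \<Rightarrow> complex \<Rightarrow> ennreal"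
  assumes f: "(\<lambda>(x, y). f x y) \<in> borel_measurable borel"
    and M: "sets M = sets circle_borel" "finite_measure M" and N: "sets N = sets circle_borel"
  shows "(\<lambda>y. \<integral>\<^sup>+x. f x y \<partial>M) \<in> borel_measurable N"
proof -
  interpret M: finite_measure M by (rule M)
  have "(\<lambda>p. (snd p, fst p)) \<in> borel_measurable (borel :: (complex \<times> complex) measure)"
    by (auto intro!: borel_measurable_continuous_onI continuous_intros)
  from measurable_compose[OF this f] have "(\<lambda>(y, x). f x y) \<in> borel_measurable borel"
    by (simp add: case_prod_beta')
  then show ?thesis
    by (intro M.borel_measurable_nn_integral measurable_circle_pair[OF _ N M(1)])
qed

lemma nn_integral_circle_swap:
  fixes f :: "complex \<Rightarrow> complex \<Rightarrow> ennreal"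
  assumes "(\<lambda>(x, y). f x y) \<in> borel_measurable borel"
    and M: "sets M = sets circle_borel" "finite_measure M"
    and N: "sets N = sets circle_borel" "finite_measure N"
  shows "(\<integral>\<^sup>+y. \<integral>\<^sup>+x. f x y \<partial>M \<partial>N) = (\<integral>\<^sup>+x. \<integral>\<^sup>+y. f x y \<partial>N \<partial>M)"
proof -
  interpret M: finite_measure M by (rule M)
  interpret N: finite_measure N by (rule N)
  interpret pair_sigma_finite M N ..
  show ?thesis
    by (rule Fubini') (use measurable_circle_pair[OF assms(1) M(1) N(1)] in simp)
qed

lemma borel_measurable_ball_indicator:
  "(\<lambda>(x, y). indicator (ball x t) (y :: complex) * indicator (circle_nbhd E s) y :: ennreal)
    \<in> borel_measurable borel"
proof -
  have "closed (UNIV \<times> circle_nbhd E s)" "open {p::complex \<times> complex. dist (fst p) (snd p) < t}"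
    by (auto intro!: closed_Times closed_circle_nbhd open_Collect_less continuous_intros simp del: split_paired_All)
  then have "(\<lambda>p. indicator {p. dist (fst p) (snd p) < t} p * indicator (UNIV \<times> circle_nbhd E s) p :: ennreal)
      \<in> borel_measurable borel"
    by (intro borel_measurable_times_ennreal borel_measurable_indicator borel_open borel_closed)
  then show ?thesis
    by (rule measurable_cong[THEN iffD1, rotated]) (auto simp: indicator_def)
qed

text \<open>Integrating over the pairs of points at distance less than t replaces a covering argument.\<close>

lemma emeasure_circle_nbhd_le:
  assumes sets: "sets \<mu> = sets circle_borel" and fin: "finite_measure \<mu>"
    and E: "closed E" "E \<noteq> {}"
    and growth: "\<And>\<zeta> r. \<zeta> \<in> E \<Longrightarrow> 0 < r \<Longrightarrow>
      emeasure \<mu> (unit_circle \<inter> ball \<zeta> r) \<le> ennreal (A * r powr \<alpha>)"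
    and t: "0 < t" "t \<le> 1"
  shows "ennreal t * emeasure \<mu> (circle_nbhd E t)
    \<le> ennreal (A * (4 * t) powr \<alpha>) * emeasure arc_length (circle_nbhd E (2 * t))"
proof -
  let ?K = "circle_nbhd E t" and ?L = "circle_nbhd E (2 * t)"
  let ?f = "\<lambda>z \<xi>. indicator (ball z t) \<xi> * indicator ?K \<xi> :: ennreal"
  have space: "space \<mu> = unit_circle"
    using sets_eq_imp_space_eq[OF sets] by (simp add: space_restrict_space)
  have ind: "indicator (ball z t) \<xi> * indicator ?K \<xi>
      = (indicator (unit_circle \<inter> ball z t \<inter> ?K) \<xi> :: ennreal)" for z \<xi>
    by (auto simp: indicator_def circle_nbhd_def)
  have ballK: "unit_circle \<inter> ball z t \<inter> ?K \<in> sets circle_borel" for z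
    by (intro sets.Int ball_circle_sets circle_nbhd_sets)
  have "ennreal t * emeasure \<mu> ?K = (\<integral>\<^sup>+\<xi>. ennreal t * indicator ?K \<xi> \<partial>\<mu>)"
    by (simp add: nn_integral_cmult_indicator circle_nbhd_sets sets)
  \<comment> \<open>Every point of \<open>?K\<close> has arc length at least t within distance t;
    this is where t <= 1 is used.\<close>
  also have "\<dots> \<le> (\<integral>\<^sup>+\<xi>. \<integral>\<^sup>+z. ?f z \<xi> \<partial>arc_length \<partial>\<mu>)"
  proof (rule nn_integral_mono)
    fix \<xi> assume "\<xi> \<in> space \<mu>"
    then have \<xi>: "\<xi> \<in> unit_circle" by (simp add: space)
    have "(\<integral>\<^sup>+z. ?f z \<xi> \<partial>arc_length)
        = (\<integral>\<^sup>+z. indicator ?K \<xi> * indicator (unit_circle \<inter> ball \<xi> t) z \<partial>arc_length)"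
      by (rule nn_integral_cong) (auto simp: indicator_def dist_commute space_arc_length)
    also have "\<dots> = indicator ?K \<xi> * emeasure arc_length (unit_circle \<inter> ball \<xi> t)"
      by (rule nn_integral_cmult_indicator) (simp add: sets_arc_length ball_circle_sets)
    finally show "ennreal t * indicator ?K \<xi> \<le> (\<integral>\<^sup>+z. ?f z \<xi> \<partial>arc_length)"
      using emeasure_arc_length_ball_ge[OF \<xi> t] by (simp add: indicator_def)
  qed
  also have "\<dots> = (\<integral>\<^sup>+z. \<integral>\<^sup>+\<xi>. ?f z \<xi> \<partial>\<mu> \<partial>arc_length)"
    by (rule nn_integral_circle_swap[OF borel_measurable_ball_indicator sets_arc_length
        finite_measure_arc_length sets fin])
  also have "\<dots> \<le> (\<integral>\<^sup>+z. ennreal (A * (4 * t) powr \<alpha>) * indicator ?L z \<partial>arc_length)"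
  proof (rule nn_integral_mono)
    fix z assume "z \<in> space arc_length"
    then have z: "z \<in> unit_circle" by (simp add: space_arc_length)
    have eq: "(\<integral>\<^sup>+\<xi>. ?f z \<xi> \<partial>\<mu>) = emeasure \<mu> (unit_circle \<inter> ball z t \<inter> ?K)"
      unfolding ind using ballK by (simp add: sets)
    show "(\<integral>\<^sup>+\<xi>. ?f z \<xi> \<partial>\<mu>) \<le> ennreal (A * (4 * t) powr \<alpha>) * indicator ?L z"
    proof (cases "z \<in> ?L")
      case True
      \<comment> \<open>The disc is enlarged to radius 2 t because z is only known to lie within 2 t
        of E; the doubling in \<open>emeasure_ball_near\<close> then produces 4 t.\<close>
      have "emeasure \<mu> (unit_circle \<inter> ball z t \<inter> ?K) \<le> emeasure \<mu> (unit_circle \<inter> ball z (2 * t))"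
        using t by (intro emeasure_mono) (auto simp: sets ball_circle_sets)
      also have "\<dots> \<le> ennreal (A * (2 * (2 * t)) powr \<alpha>)"
        using t by (intro emeasure_ball_near[OF sets E growth True]) auto
      finally show ?thesis using True by (simp add: eq)
    next
      case False
      have "unit_circle \<inter> ball z t \<inter> ?K = {}"
      proof (rule ccontr)
        assume "unit_circle \<inter> ball z t \<inter> ?K \<noteq> {}"
        then obtain \<xi> where "dist z \<xi> < t" "infdist \<xi> E \<le> t"
          by (auto simp: circle_nbhd_def)
        then have "infdist z E \<le> 2 * t"
          using infdist_triangle[of z E \<xi>] by simp
        with False z show False by (simp add: circle_nbhd_def)
      qed
      then show ?thesis by (simp add: eq)
    qed
  qed
  also have "\<dots> = ennreal (A * (4 * t) powr \<alpha>) * emeasure arc_length ?L"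
    by (simp add: nn_integral_cmult_indicator circle_nbhd_sets sets_arc_length)
  finally show ?thesis .
qed

section \<open>Piecewise linear profiles and their interaction energy\<close>

definition bump :: "real \<Rightarrow> real \<Rightarrow> real"
  where "bump h t = max 0 (min 1 (2 - 2 * t / h))"

lemma bump_bounds: "0 \<le> bump h t" "bump h t \<le> 1"
  by (auto simp: bump_def)

lemma bump_eq_1: "0 < h \<Longrightarrow> t \<le> h / 2 \<Longrightarrow> bump h t = 1"
  by (auto simp: bump_def field_simps)

lemma bump_eq_0: "0 < h \<Longrightarrow> h \<le> t \<Longrightarrow> bump h t = 0"
  by (auto simp: bump_def field_simps)

lemma bump_diff_le:
  assumes "0 < h"
  shows "\<bar>bump h x - bump h y\<bar> \<le> 2 * \<bar>x - y\<bar> / h"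
proof -
  have "\<bar>bump h x - bump h y\<bar> \<le> \<bar>(2 - 2 * x / h) - (2 - 2 * y / h)\<bar>"
    unfolding bump_def by (auto simp: max_def min_def abs_if)
  also have "(2 - 2 * x / h) - (2 - 2 * y / h) = 2 * (y - x) / h"
    by (simp add: diff_divide_distrib algebra_simps)
  also have "\<bar>\<dots>\<bar> = 2 * \<bar>x - y\<bar> / h"
    using assms by (simp only: abs_mult abs_divide abs_minus_commute[of y])
  finally show ?thesis .
qed

lemma continuous_on_bump [continuous_intros]:
  "continuous_on S f \<Longrightarrow> continuous_on S (\<lambda>x. bump h (f x))"
  unfolding bump_def by (cases "h = 0") (auto intro!: continuous_intros)

text \<open>If k >= h / 4, both profiles are Lipschitz with constant of order 1 / h. If k < h / 4
  and both differences are nonzero, one argument is below k and the other above h / 2, so they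
  differ by at least h / 4 and the trivial bound 1 is good enough. The indicators record that the
  finer profile vanishes from k on.\<close>

lemma bump_product_le:
  assumes k: "0 < k" "k \<le> h" and q: "\<bar>x - y\<bar> \<le> q"
  shows "\<bar>bump h x - bump h y\<bar> * \<bar>bump k x - bump k y\<bar>
    \<le> (of_bool (x \<le> k) + of_bool (y \<le> k)) * (32 * q\<^sup>2 / (q\<^sup>2 + h\<^sup>2))"
proof -
  have h: "0 < h" and q0: "0 \<le> q" using assms by auto
  define X where "X = \<bar>bump h x - bump h y\<bar>"
  define Y where "Y = \<bar>bump k x - bump k y\<bar>"
  have XY: "0 \<le> X" "X \<le> 1" "0 \<le> Y" "Y \<le> 1"
    using bump_bounds[of h x] bump_bounds[of h y] bump_bounds[of k x] bump_bounds[of k y]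
    by (auto simp: X_def Y_def)
  have pos: "0 < q\<^sup>2 + h\<^sup>2" using h by (simp add: add_nonneg_pos)
  have rhs0: "0 \<le> 32 * q\<^sup>2 / (q\<^sup>2 + h\<^sup>2)" by simp
  show ?thesis
  proof (cases "X * Y = 0")
    case True
    moreover have "0 \<le> (of_bool (x \<le> k) + of_bool (y \<le> k)) * (32 * q\<^sup>2 / (q\<^sup>2 + h\<^sup>2))"
      by simp
    ultimately show ?thesis by (simp only: X_def Y_def)
  next
    case False
    then have nz: "X \<noteq> 0" "Y \<noteq> 0" by auto
    have one: "1 \<le> (of_bool (x \<le> k) + of_bool (y \<le> k) :: real)"
    proof -
      have "x \<le> k \<or> y \<le> k"
        using nz(2) bump_eq_0[OF k(1), of x] bump_eq_0[OF k(1), of y] by (force simp: Y_def)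
      then show ?thesis by auto
    qed
    have "X * Y \<le> 16 * q\<^sup>2 / h\<^sup>2"
    proof (cases "h / 4 \<le> k")
      case True
      have "X \<le> 2 * q / h"
        using bump_diff_le[OF h, of x y] q h unfolding X_def
        by (meson divide_right_mono less_imp_le mult_left_mono order_trans zero_le_numeral)
      moreover have "Y \<le> 8 * q / h"
      proof -
        have "Y \<le> 2 * q / k"
          using bump_diff_le[OF k(1), of x y] q k(1) unfolding Y_def
          by (meson divide_right_mono less_imp_le mult_left_mono order_trans zero_le_numeral)
        also have "\<dots> \<le> 2 * q / (h / 4)"
          using True h q0 k by (intro divide_left_mono) auto
        finally show ?thesis by simp
      qed
      ultimately have "X * Y \<le> (2 * q / h) * (8 * q / h)"
        using XY h q0 by (intro mult_mono) auto
      then show ?thesis by (simp add: power2_eq_square)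
    next
      case False
      have "h / 4 \<le> q"
        using nz bump_eq_0[of k x] bump_eq_0[of k y] bump_eq_1[of h x] bump_eq_1[of h y] k h q False
        unfolding X_def Y_def by (cases "x \<le> h / 2"; cases "y \<le> h / 2"; cases "x < k"; cases "y < k") auto
      then have "(h / 4)\<^sup>2 \<le> q\<^sup>2" using h by (intro power_mono) auto
      then have "1 \<le> 16 * q\<^sup>2 / h\<^sup>2" using h by (simp add: power_divide field_simps)
      moreover have "X * Y \<le> 1" using XY by (simp add: mult_le_one)
      ultimately show ?thesis by linarith
    qed
    moreover have "X * Y \<le> 1" using XY by (simp add: mult_le_one)
    \<comment> \<open>The bounds 1 and 16 q^2 / h^2 merge at the cost of a factor 2: for q <= h the
      denominator q^2 + h^2 is at most 2 h^2, and for q > h the right side already exceeds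
      1.\<close>
    ultimately have "X * Y \<le> 32 * q\<^sup>2 / (q\<^sup>2 + h\<^sup>2)"
    proof (cases "q\<^sup>2 \<le> h\<^sup>2")
      case True
      assume "X * Y \<le> 16 * q\<^sup>2 / h\<^sup>2"
      also have "\<dots> = 32 * q\<^sup>2 / (h\<^sup>2 + h\<^sup>2)" by simp
      also have "\<dots> \<le> 32 * q\<^sup>2 / (q\<^sup>2 + h\<^sup>2)"
        using True pos h by (intro divide_left_mono) auto
      finally show ?thesis .
    next
      case False
      assume "X * Y \<le> 1"
      also have "1 \<le> 32 * q\<^sup>2 / (q\<^sup>2 + h\<^sup>2)"
        using False pos by (simp add: le_divide_eq)
      finally show ?thesis .
    qed
    also have "\<dots> \<le> (of_bool (x \<le> k) + of_bool (y \<le> k)) * (32 * q\<^sup>2 / (q\<^sup>2 + h\<^sup>2))"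
      using mult_right_mono[OF one rhs0] by simp
    finally show ?thesis by (simp add: X_def Y_def)
  qed
qed

text \<open>The square consists of the diagonal once and the pairs n < m twice. Ordering the pairs
  matters because the bound on a product of two profiles treats the coarser and the finer scale
  differently.\<close>

lemma sum_square_le_triangle:
  fixes x :: "nat \<Rightarrow> real"
  assumes "\<And>n. 0 \<le> x n"
  shows "(\<Sum>n=N..<M. x n)\<^sup>2 \<le> 2 * (\<Sum>n=N..<M. \<Sum>m=n..<M. x n * x m)"
proof (induction M)
  case (Suc M)
  show ?case
  proof (cases "N \<le> M")
    case True
    have "(\<Sum>n=N..<M. \<Sum>m=n..<Suc M. x n * x m)
        = (\<Sum>n=N..<M. (\<Sum>m=n..<M. x n * x m) + x n * x M)"
      by (intro sum.cong) auto
    also have "\<dots> = (\<Sum>n=N..<M. \<Sum>m=n..<M. x n * x m) + (\<Sum>n=N..<M. x n) * x M"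
      by (simp add: sum.distrib sum_distrib_right)
    finally have "2 * (\<Sum>n=N..<Suc M. \<Sum>m=n..<Suc M. x n * x m)
        = 2 * (\<Sum>n=N..<M. \<Sum>m=n..<M. x n * x m) + 2 * (\<Sum>n=N..<M. x n) * x M + 2 * (x M)\<^sup>2"
      using True by (simp add: power2_eq_square)
    moreover have "(\<Sum>n=N..<Suc M. x n)\<^sup>2
        = (\<Sum>n=N..<M. x n)\<^sup>2 + 2 * (\<Sum>n=N..<M. x n) * x M + (x M)\<^sup>2"
      using True by (simp add: power2_sum)
    ultimately show ?thesis using Suc.IH zero_le_power2[of "x M"] by linarith
  qed simp
qed simp

text \<open>The two indicators are added instead of forming a union, so that the energy splits into
  two double integrals, each of which can be integrated in its own favourable order. Multiplied by
  32 |z - \<xi>|^2 this is the bound of \<open>bump_product_le\<close>.\<close>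

definition nbhd_kernel :: "complex set \<Rightarrow> real \<Rightarrow> real \<Rightarrow> complex \<Rightarrow> complex \<Rightarrow> real"
  where "nbhd_kernel E k h z \<xi>
    = (of_bool (infdist z E \<le> k) + of_bool (infdist \<xi> E \<le> k)) * (1 / ((dist z \<xi>)\<^sup>2 + h\<^sup>2))"

lemma nbhd_kernel_nonneg: "0 \<le> nbhd_kernel E k h z \<xi>"
  by (simp add: nbhd_kernel_def)

lemma nbhd_kernel_measurable:
  assumes "h > 0"
  shows "(\<lambda>(z, \<xi>). ennreal (nbhd_kernel E k h z \<xi>)) \<in> borel_measurable borel"
proof -
  have "closed {p :: complex \<times> complex. infdist (fst p) E \<le> k}"
    "closed {p :: complex \<times> complex. infdist (snd p) E \<le> k}"
    by (auto intro!: closed_Collect_le continuous_intros simp del: split_paired_All)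
  then have ind: "(\<lambda>p. indicator {p :: complex \<times> complex. infdist (fst p) E \<le> k} p :: real) \<in> borel_measurable borel"
    "(\<lambda>p. indicator {p :: complex \<times> complex. infdist (snd p) E \<le> k} p :: real) \<in> borel_measurable borel"
    by (auto intro!: borel_measurable_indicator)
  have "continuous_on UNIV (\<lambda>p :: complex \<times> complex. 1 / ((dist (fst p) (snd p))\<^sup>2 + h\<^sup>2))"
    using assms by (intro continuous_intros) (auto simp: add_nonneg_eq_0_iff)
  then have "(\<lambda>p :: complex \<times> complex. 1 / ((dist (fst p) (snd p))\<^sup>2 + h\<^sup>2)) \<in> borel_measurable borel"
    by (rule borel_measurable_continuous_onI)
  then have "(\<lambda>p. ennreal ((indicator {p :: complex \<times> complex. infdist (fst p) E \<le> k} p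
      + indicator {p :: complex \<times> complex. infdist (snd p) E \<le> k} p)
      * (1 / ((dist (fst p) (snd p))\<^sup>2 + h\<^sup>2)))) \<in> borel_measurable borel"
    using ind by (intro measurable_compose[OF _ measurable_ennreal] borel_measurable_times borel_measurable_add)
  then show ?thesis
    by (simp add: nbhd_kernel_def case_prod_beta' indicator_def of_bool_def)
qed

text \<open>For z near E, integrate first over \<xi>: the growth of \<mu> gives h^(\<alpha> - 2),
  and the length of the neighbourhood remains. For \<xi> near E, integrate first over z: arc length
  gives 1 / h, and the remaining \<mu>-mass of the neighbourhood is converted into length by
  \<open>emeasure_circle_nbhd_le\<close>.\<close>

lemma nbhd_energy_le:
  assumes sets: "sets \<mu> = sets circle_borel" and fin: "finite_measure \<mu>"
    and E: "closed E" "E \<noteq> {}"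
    and growth: "\<And>\<zeta> r. \<zeta> \<in> E \<Longrightarrow> 0 < r \<Longrightarrow>
      emeasure \<mu> (unit_circle \<inter> ball \<zeta> r) \<le> ennreal (A * r powr \<alpha>)"
    and A: "0 \<le> A" and \<alpha>: "1 \<le> \<alpha>" "\<alpha> < 2" and k: "0 < k" "k \<le> h" "k \<le> 1"
  shows "(\<integral>\<^sup>+\<xi>. \<integral>\<^sup>+z. ennreal (nbhd_kernel E k h z \<xi>) \<partial>arc_length \<partial>\<mu>)
    \<le> ennreal ((4 * A * 2 powr \<alpha> / (1 - 2 powr (\<alpha> - 2)) + 96 * A * 4 powr \<alpha>)
        * h powr (\<alpha> - 2) * measure arc_length (circle_nbhd E (2 * k)))"
proof -
  have h: "0 < h" using k by simp
  interpret \<mu>: finite_measure \<mu> by (rule fin)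
  interpret \<sigma>: finite_measure arc_length by (rule finite_measure_arc_length)
  have space: "space \<mu> = unit_circle"
    using sets_eq_imp_space_eq[OF sets] by (simp add: space_restrict_space)
  define K where "K = circle_nbhd E k"
  define e where "e = measure arc_length (circle_nbhd E (2 * k))"
  define \<kappa> where "\<kappa> = (\<lambda>z \<xi> :: complex. ennreal (1 / ((dist z \<xi>)\<^sup>2 + h\<^sup>2)))"
  define c1 where "c1 = 4 * (A * 2 powr \<alpha>) * h powr (\<alpha> - 2) / (1 - 2 powr (\<alpha> - 2))"
  have c1: "0 \<le> c1"
    using A \<alpha> powr_less_mono[of "\<alpha> - 2" 0 2] by (simp add: c1_def)
  have Ksets: "K \<in> sets \<mu>" "K \<in> sets arc_length"
    by (auto simp: K_def sets sets_arc_length circle_nbhd_sets)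
  \<comment> \<open>The radius is doubled so that both terms carry the same factor e; the conversion
    of mass into length needs 2 k.\<close>
  have e: "emeasure arc_length K \<le> ennreal e"
    unfolding e_def \<sigma>.emeasure_eq_measure[symmetric] K_def using k
    by (intro emeasure_mono circle_nbhd_mono) (auto simp: sets_arc_length circle_nbhd_sets)
  have \<kappa>m: "(\<lambda>(z, \<xi>). \<kappa> z \<xi>) \<in> borel_measurable borel"
  proof -
    have "continuous_on UNIV (\<lambda>p :: complex \<times> complex. 1 / ((dist (fst p) (snd p))\<^sup>2 + h\<^sup>2))"
      using h by (intro continuous_intros) (auto simp: add_nonneg_eq_0_iff)
    from measurable_compose[OF borel_measurable_continuous_onI[OF this] measurable_ennreal]
    show ?thesis by (simp add: \<kappa>_def case_prod_beta')
  qed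
  have indm: "(\<lambda>(z, \<xi>). indicator K z * \<kappa> z \<xi>) \<in> borel_measurable borel"
    "(\<lambda>(z, \<xi>). indicator K \<xi> * \<kappa> z \<xi>) \<in> borel_measurable borel"
  proof -
    have "(\<lambda>p. indicator (K \<times> UNIV) p * (case p of (z, \<xi>) \<Rightarrow> \<kappa> z \<xi>)) \<in> borel_measurable borel"
      "(\<lambda>p. indicator (UNIV \<times> K) p * (case p of (z, \<xi>) \<Rightarrow> \<kappa> z \<xi>)) \<in> borel_measurable borel"
      unfolding K_def
      by (intro \<kappa>m borel_measurable_times_ennreal borel_measurable_indicator borel_closed closed_Times
          closed_circle_nbhd closed_UNIV)+
    then show "(\<lambda>(z, \<xi>). indicator K z * \<kappa> z \<xi>) \<in> borel_measurable borel"
      "(\<lambda>(z, \<xi>). indicator K \<xi> * \<kappa> z \<xi>) \<in> borel_measurable borel"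
      by (auto simp: indicator_times case_prod_beta')
  qed
  have split: "ennreal (nbhd_kernel E k h z \<xi>) = indicator K z * \<kappa> z \<xi> + indicator K \<xi> * \<kappa> z \<xi>"
    if "z \<in> unit_circle" "\<xi> \<in> unit_circle" for z \<xi>
    using that
    by (auto simp: nbhd_kernel_def \<kappa>_def K_def circle_nbhd_def indicator_def mult_2
        simp flip: ennreal_plus)
  have "(\<integral>\<^sup>+\<xi>. \<integral>\<^sup>+z. ennreal (nbhd_kernel E k h z \<xi>) \<partial>arc_length \<partial>\<mu>)
      = (\<integral>\<^sup>+\<xi>. \<integral>\<^sup>+z. indicator K z * \<kappa> z \<xi> + indicator K \<xi> * \<kappa> z \<xi> \<partial>arc_length \<partial>\<mu>)"
    by (intro nn_integral_cong) (auto simp: split space space_arc_length)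
  also have "\<dots> = (\<integral>\<^sup>+\<xi>. (\<integral>\<^sup>+z. indicator K z * \<kappa> z \<xi> \<partial>arc_length)
      + (\<integral>\<^sup>+z. indicator K \<xi> * \<kappa> z \<xi> \<partial>arc_length) \<partial>\<mu>)"
    by (intro nn_integral_cong nn_integral_add measurable_circle_pair_inner[OF indm(1)]
        measurable_circle_pair_inner[OF indm(2)] sets_arc_length)
  also have "\<dots> = (\<integral>\<^sup>+\<xi>. \<integral>\<^sup>+z. indicator K z * \<kappa> z \<xi> \<partial>arc_length \<partial>\<mu>)
      + (\<integral>\<^sup>+\<xi>. \<integral>\<^sup>+z. indicator K \<xi> * \<kappa> z \<xi> \<partial>arc_length \<partial>\<mu>)"
    by (intro nn_integral_add measurable_circle_nn_integral[OF indm(1)]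
        measurable_circle_nn_integral[OF indm(2)] sets_arc_length finite_measure_arc_length sets)
  also have "\<dots> \<le> ennreal (c1 * e) + ennreal (96 * A * 4 powr \<alpha> * h powr (\<alpha> - 2) * e)"
  proof (rule add_mono)
    have "(\<integral>\<^sup>+\<xi>. \<integral>\<^sup>+z. indicator K z * \<kappa> z \<xi> \<partial>arc_length \<partial>\<mu>)
        = (\<integral>\<^sup>+z. \<integral>\<^sup>+\<xi>. indicator K z * \<kappa> z \<xi> \<partial>\<mu> \<partial>arc_length)"
      by (rule nn_integral_circle_swap[OF indm(1) sets_arc_length finite_measure_arc_length sets fin])
    also have "\<dots> \<le> (\<integral>\<^sup>+z. ennreal c1 * indicator K z \<partial>arc_length)"
    proof (rule nn_integral_mono)
      fix z
      have "(\<integral>\<^sup>+\<xi>. \<kappa> z \<xi> \<partial>\<mu>) \<le> ennreal c1" if z: "z \<in> K"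
        unfolding \<kappa>_def c1_def
      proof (rule nn_integral_kernel_le[OF sets h _ \<alpha>(2)])
        fix r assume "h \<le> r"
        then show "emeasure \<mu> (unit_circle \<inter> ball z r) \<le> ennreal (A * 2 powr \<alpha> * r powr \<alpha>)"
          using emeasure_ball_near[OF sets E growth z[unfolded K_def], of r] h k
          by (simp add: powr_mult mult.assoc)
      qed (use A in simp)
      then show "(\<integral>\<^sup>+\<xi>. indicator K z * \<kappa> z \<xi> \<partial>\<mu>) \<le> ennreal c1 * indicator K z"
        by (simp add: indicator_def)
    qed
    also have "\<dots> \<le> ennreal c1 * ennreal e"
      using Ksets e by (simp add: nn_integral_cmult_indicator mult_left_mono)
    also have "\<dots> = ennreal (c1 * e)"
      using c1 by (simp add: ennreal_mult e_def)
    finally show "(\<integral>\<^sup>+\<xi>. \<integral>\<^sup>+z. indicator K z * \<kappa> z \<xi> \<partial>arc_length \<partial>\<mu>) \<le> ennreal (c1 * e)" .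
  next
    have "(\<integral>\<^sup>+\<xi>. \<integral>\<^sup>+z. indicator K \<xi> * \<kappa> z \<xi> \<partial>arc_length \<partial>\<mu>)
        \<le> (\<integral>\<^sup>+\<xi>. ennreal (96 / h) * indicator K \<xi> \<partial>\<mu>)"
    proof (rule nn_integral_mono)
      fix \<xi> assume "\<xi> \<in> space \<mu>"
      then have \<xi>: "\<xi> \<in> unit_circle" by (simp add: space)
      have "(\<integral>\<^sup>+z. \<kappa> z \<xi> \<partial>arc_length) = (\<integral>\<^sup>+z. ennreal (1 / ((dist \<xi> z)\<^sup>2 + h\<^sup>2)) \<partial>arc_length)"
        by (simp add: \<kappa>_def dist_commute)
      also have "\<dots> \<le> ennreal (4 * 12 * h powr (1 - 2) / (1 - 2 powr (1 - 2)))"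
        using h \<xi> by (intro nn_integral_kernel_le sets_arc_length)
          (auto intro: order.trans[OF emeasure_arc_length_ball_le])
      \<comment> \<open>The disc constant 12 enters with exponent 1, and 1 - 2^(-1) = 1 / 2 doubles
        48 to 96.\<close>
      also have "4 * 12 * h powr (1 - 2) / (1 - 2 powr (1 - 2)) = 96 / h"
        using h by (simp add: powr_minus_divide)
      finally show "(\<integral>\<^sup>+z. indicator K \<xi> * \<kappa> z \<xi> \<partial>arc_length) \<le> ennreal (96 / h) * indicator K \<xi>"
        by (simp add: indicator_def)
    qed
    also have "\<dots> = ennreal (96 / h) * ennreal (measure \<mu> K)"
      using Ksets by (simp add: nn_integral_cmult_indicator \<mu>.emeasure_eq_measure)
    also have "\<dots> = ennreal (96 / h * measure \<mu> K)"
      using h by (intro ennreal_mult[symmetric]) auto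
    also have "\<dots> \<le> ennreal (96 * A * 4 powr \<alpha> * h powr (\<alpha> - 2) * e)"
    proof (rule ennreal_leI)
      have "ennreal (k * measure \<mu> K) \<le> ennreal (A * (4 * k) powr \<alpha> * e)"
        using emeasure_circle_nbhd_le[OF sets fin E growth k(1,3)] A k
        by (simp add: \<mu>.emeasure_eq_measure \<sigma>.emeasure_eq_measure K_def e_def ennreal_mult)
      then have "k * measure \<mu> K \<le> A * (4 * k) powr \<alpha> * e"
        using A by (subst (asm) ennreal_le_iff) (auto simp: e_def)
      also have "\<dots> = k * (A * 4 powr \<alpha> * k powr (\<alpha> - 1) * e)"
        using k by (simp add: powr_mult powr_diff)
      finally have "measure \<mu> K \<le> A * 4 powr \<alpha> * k powr (\<alpha> - 1) * e"
        using k by simp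
      \<comment> \<open>Here k <= h and 1 <= \<alpha> trade the finer scale for the coarser one;
        with the factor 1 / h this becomes h^(\<alpha> - 2), matching the other term.\<close>
      also have "\<dots> \<le> A * 4 powr \<alpha> * h powr (\<alpha> - 1) * e"
        using k A \<alpha> by (intro mult_right_mono mult_left_mono powr_mono2) (auto simp: e_def)
      finally have "96 / h * measure \<mu> K \<le> 96 / h * (A * 4 powr \<alpha> * h powr (\<alpha> - 1) * e)"
        using h by (intro mult_left_mono) auto
      also have "\<dots> = 96 * A * 4 powr \<alpha> * h powr (\<alpha> - 2) * e"
        using h by (simp add: powr_diff powr_numeral power2_eq_square)
      finally show "96 / h * measure \<mu> K \<le> 96 * A * 4 powr \<alpha> * h powr (\<alpha> - 2) * e" .
    qed
    finally show "(\<integral>\<^sup>+\<xi>. \<integral>\<^sup>+z. indicator K \<xi> * \<kappa> z \<xi> \<partial>arc_length \<partial>\<mu>)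
        \<le> ennreal (96 * A * 4 powr \<alpha> * h powr (\<alpha> - 2) * e)" .
  qed
  also have "\<dots> = ennreal (c1 * e + 96 * A * 4 powr \<alpha> * h powr (\<alpha> - 2) * e)"
    using c1 A by (intro ennreal_plus[symmetric]) (auto simp: e_def)
  also have "c1 * e + 96 * A * 4 powr \<alpha> * h powr (\<alpha> - 2) * e
      = (4 * A * 2 powr \<alpha> / (1 - 2 powr (\<alpha> - 2)) + 96 * A * 4 powr \<alpha>) * h powr (\<alpha> - 2) * e"
    by (simp add: c1_def algebra_simps)
  finally show ?thesis by (simp add: e_def)
qed

section \<open>Arc neighbourhoods and chordal neighbourhoods\<close>

lemma
  assumes "z \<in> unit_circle" "w \<in> unit_circle"
  shows arc_dist_bounds: "0 \<le> arc_dist z w" "arc_dist z w \<le> pi"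
    and dist_eq_sin_arc_dist: "dist z w = 2 * sin (arc_dist z w / 2)"
proof -
  show bounds: "0 \<le> arc_dist z w" "arc_dist z w \<le> pi"
    using Arg_bounded[of "w / z"] by (auto simp: arc_dist_def)
  have [simp]: "cmod z = 1" "cmod w = 1" "z \<noteq> 0" "w \<noteq> 0" using assms by auto
  define \<theta> where "\<theta> = Arg (w / z)"
  have "w = z * cis \<theta>"
    by (simp add: \<theta>_def cis_Arg sgn_div_norm norm_divide)
  then have "w - z = z * (cis \<theta> - cis 0)"
    by (simp add: algebra_simps)
  then have "dist z w = cmod (cis \<theta> - cis 0)"
    by (simp add: dist_norm norm_minus_commute[of z] norm_mult)
  also have "\<dots> = 2 * sin (\<bar>\<theta>\<bar> / 2)"
  proof -
    have "0 \<le> sin (\<bar>\<theta>\<bar> / 2)"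
      using Arg_bounded[of "w / z"] by (intro sin_ge_zero) (auto simp: \<theta>_def)
    moreover have "sin (\<bar>\<theta>\<bar> / 2) = \<bar>sin (\<theta> / 2)\<bar> \<or> sin (\<bar>\<theta>\<bar> / 2) = - \<bar>sin (\<theta> / 2)\<bar>"
      by (cases "0 \<le> \<theta>") (auto simp: abs_if)
    ultimately show ?thesis
      using cmod_cis_minus_cis[of \<theta> 0] by auto
  qed
  finally show "dist z w = 2 * sin (arc_dist z w / 2)"
    by (simp add: arc_dist_def \<theta>_def)
qed

lemma arc_dist_le_iff:
  assumes "z \<in> unit_circle" "w \<in> unit_circle" "0 \<le> t" "t \<le> pi"
  shows "arc_dist z w \<le> t \<longleftrightarrow> dist z w \<le> 2 * sin (t / 2)"
  using arc_dist_bounds[OF assms(1,2)] assms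
  by (simp add: dist_eq_sin_arc_dist sin_mono_le_eq)

text \<open>The chord is 2 sin of half the arc, which increases strictly on [0, pi]. Hence a nearest
  point for the chordal distance is also nearest for the arc distance, and the infimum over E is
  attained since E is closed.\<close>

lemma arc_nbhd_eq:
  assumes E: "E \<subseteq> unit_circle" "closed E" "E \<noteq> {}" and t: "0 \<le> t" "t \<le> pi"
  shows "arc_nbhd E t = circle_nbhd E (2 * sin (t / 2))"
proof -
  have "(INF w\<in>E. ennreal (arc_dist z w)) \<le> ennreal t \<longleftrightarrow> infdist z E \<le> 2 * sin (t / 2)"
    if z: "z \<in> unit_circle" for z
  proof -
    obtain w where w: "w \<in> E" "infdist z E = dist z w"
      using infdist_attains_inf[OF E(2,3)] by blast
    have wS: "w \<in> unit_circle" using w E by auto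
    have min: "arc_dist z w \<le> arc_dist z v" if "v \<in> E" for v
    proof -
      have v: "v \<in> unit_circle" using that E by auto
      have "dist z w \<le> dist z v"
        using infdist_le[OF that, of z] w by simp
      then show ?thesis
        using arc_dist_le_iff[OF z wS arc_dist_bounds[OF z v]] dist_eq_sin_arc_dist[OF z v] by simp
    qed
    have "(INF w\<in>E. ennreal (arc_dist z w)) = ennreal (arc_dist z w)"
      using w(1) min by (intro antisym INF_lower INF_greatest ennreal_leI) auto
    then show ?thesis
      using t arc_dist_le_iff[OF z wS t] w(2) by simp
  qed
  then show ?thesis
    by (auto simp: arc_nbhd_def circle_nbhd_def)
qed

lemma circle_nbhd_subset_arc_nbhd:
  assumes E: "E \<subseteq> unit_circle" "closed E" "E \<noteq> {}" and t: "0 \<le> t" "t \<le> pi"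
  shows "circle_nbhd E (t / 2) \<subseteq> arc_nbhd E t"
  unfolding arc_nbhd_eq[OF assms] using half_le_sin[of "t / 2"] t
  by (intro circle_nbhd_mono) simp

lemma open_arc_eq:
  assumes \<zeta>: "\<zeta> \<in> unit_circle" and t: "0 \<le> t" "t \<le> pi"
  shows "open_arc \<zeta> t = unit_circle \<inter> ball \<zeta> (2 * sin (t / 2))"
proof (intro equalityI subsetI)
  have [simp]: "cmod \<zeta> = 1" "\<zeta> \<noteq> 0" using \<zeta> by auto
  {
    fix z assume "z \<in> open_arc \<zeta> t"
    then obtain \<theta> where \<theta>: "z = \<zeta> * cis \<theta>" "\<bar>\<theta>\<bar> < t"
      by (auto simp: open_arc_def)
    have "\<zeta> - z = \<zeta> * (cis 0 - cis \<theta>)"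
      by (simp add: \<theta> algebra_simps)
    then have "dist \<zeta> z = 2 * \<bar>sin (\<theta> / 2)\<bar>"
      using cmod_cis_minus_cis[of 0 \<theta>] by (simp add: dist_norm norm_mult)
    also have "\<bar>sin (\<theta> / 2)\<bar> < sin (t / 2)"
      using \<theta>(2) t sin_monotone_2pi[of "\<theta> / 2" "t / 2"] sin_monotone_2pi[of "- \<theta> / 2" "t / 2"]
      by (auto simp: abs_if split: if_splits)
    finally show "z \<in> unit_circle \<inter> ball \<zeta> (2 * sin (t / 2))"
      by (simp add: \<theta> norm_mult)
  next
    fix z assume z: "z \<in> unit_circle \<inter> ball \<zeta> (2 * sin (t / 2))"
    then have z1: "z \<in> unit_circle" by simp
    have "arc_dist \<zeta> z < t"
      using z arc_dist_le_iff[OF \<zeta> z1 t] dist_eq_sin_arc_dist[OF \<zeta> z1]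
      by (metis IntD2 linorder_not_le mem_ball order.order_iff_strict order_less_irrefl)
    moreover have "z = \<zeta> * cis (Arg (z / \<zeta>))"
      using z1 by (subst cis_Arg) (auto simp: sgn_div_norm norm_divide)
    ultimately show "z \<in> open_arc \<zeta> t"
      unfolding open_arc_def arc_dist_def by blast
  }
qed

text \<open>The asymptotic hypothesis speaks of small t only; for large radii the finite total mass
  of \<mu> takes over, at the price of a larger constant.\<close>

lemma arc_modulus_growth:
  assumes fin: "finite_measure \<mu>" and sets: "sets \<mu> = sets circle_borel"
    and E: "E \<subseteq> unit_circle" and \<alpha>: "0 \<le> \<alpha>"
    and O: "(\<lambda>t. enn2real (arc_modulus \<mu> E t)) \<in> O[at_right 0](\<lambda>t. t powr \<alpha>)"
  obtains A where "0 \<le> A" "\<And>\<zeta> r. \<zeta> \<in> E \<Longrightarrow> 0 < r \<Longrightarrow>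
    emeasure \<mu> (unit_circle \<inter> ball \<zeta> r) \<le> ennreal (A * r powr \<alpha>)"
proof -
  interpret finite_measure \<mu> by (rule fin)
  have space: "space \<mu> = unit_circle"
    using sets_eq_imp_space_eq[OF sets] by (simp add: space_restrict_space)
  obtain C where C: "C > 0"
    "eventually (\<lambda>t. norm (enn2real (arc_modulus \<mu> E t)) \<le> C * norm (t powr \<alpha>)) (at_right 0)"
    using O by (rule landau_o.bigE)
  then obtain d where d: "d > 0" "\<And>t. 0 < t \<Longrightarrow> t < d \<Longrightarrow> enn2real (arc_modulus \<mu> E t) \<le> C * t powr \<alpha>"
    by (auto simp: eventually_at_right_field)
  define s where "s = min d pi"
  have s: "0 < s" "s \<le> d" "s \<le> pi" using d by (auto simp: s_def)
  define m where "m = measure \<mu> unit_circle"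
  have m: "emeasure \<mu> B \<le> ennreal m" for B
    using emeasure_space[of \<mu> B] by (simp add: m_def space emeasure_eq_measure)
  \<comment> \<open>The first summand serves 2 r < s, where the disc lies in an arc of half-width 2
    r; the second serves 2 r >= s, where m <= m (2 r / s)^\<alpha>.\<close>
  define A where "A = C * 2 powr \<alpha> + m * (2 / s) powr \<alpha>"
  have parts: "0 \<le> C * 2 powr \<alpha>" "0 \<le> m * (2 / s) powr \<alpha>" using C by (auto simp: m_def)
  show ?thesis
  proof (rule that)
    show "0 \<le> A" using parts by (simp add: A_def)
    fix \<zeta> r assume \<zeta>: "\<zeta> \<in> E" and r: "(0::real) < r"
    have \<zeta>S: "\<zeta> \<in> unit_circle" using \<zeta> E by auto
    show "emeasure \<mu> (unit_circle \<inter> ball \<zeta> r) \<le> ennreal (A * r powr \<alpha>)"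
    proof (cases "2 * r < s")
      case True
      have arc: "open_arc \<zeta> (2 * r) = unit_circle \<inter> ball \<zeta> (2 * sin r)"
        using open_arc_eq[OF \<zeta>S, of "2 * r"] True r s by simp
      have "r / 2 \<le> sin r" using True r s by (intro half_le_sin) auto
      then have "unit_circle \<inter> ball \<zeta> r \<subseteq> open_arc \<zeta> (2 * r)"
        unfolding arc by auto
      then have "emeasure \<mu> (unit_circle \<inter> ball \<zeta> r) \<le> emeasure \<mu> (open_arc \<zeta> (2 * r))"
        by (rule emeasure_mono) (simp add: arc sets ball_circle_sets)
      also have "\<dots> \<le> arc_modulus \<mu> E (2 * r)"
        unfolding arc_modulus_def using \<zeta> by (rule SUP_upper)
      \<comment> \<open>\<open>enn2real\<close> sends infinity to 0, so the modulus must be seen to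
        be finite before the real-valued bound says anything about it.\<close>
      also have "\<dots> = ennreal (enn2real (arc_modulus \<mu> E (2 * r)))"
      proof -
        have "arc_modulus \<mu> E (2 * r) \<le> ennreal m"
          unfolding arc_modulus_def by (intro SUP_least m)
        then show ?thesis
          by (metis ennreal_enn2real ennreal_less_top le_less_trans)
      qed
      also have "\<dots> \<le> ennreal (C * (2 * r) powr \<alpha>)"
        using d(2)[of "2 * r"] True r s by (intro ennreal_leI) auto
      also have "\<dots> \<le> ennreal (A * r powr \<alpha>)"
        using parts r by (intro ennreal_leI) (simp add: A_def powr_mult mult_right_mono flip: mult.assoc)
      finally show ?thesis .
    next
      case False
      have "1 \<le> (2 / s * r) powr \<alpha>"
        using False s r \<alpha> by (intro ge_one_powr_ge_zero) (auto simp: field_simps)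
      then have "m * 1 \<le> m * (2 / s * r) powr \<alpha>"
        by (intro mult_left_mono) (auto simp: m_def)
      also have "\<dots> = m * (2 / s) powr \<alpha> * r powr \<alpha>"
        using s r by (simp only: powr_mult mult.assoc)
      also have "\<dots> \<le> A * r powr \<alpha>"
        using parts r by (intro mult_right_mono) (auto simp: A_def)
      finally show ?thesis
        using order.trans[OF m] by (auto intro: ennreal_leI)
    qed
  qed
qed

section \<open>The test functions\<close>

definition cutoff :: "complex set \<Rightarrow> (nat \<Rightarrow> real) \<Rightarrow> nat \<Rightarrow> nat \<Rightarrow> complex \<Rightarrow> real"
  where "cutoff E a N M z = (\<Sum>n=N..<M. a n * bump ((1 / 2) ^ n) (infdist z E))"

lemma continuous_on_cutoff: "continuous_on S (cutoff E a N M)"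
  unfolding cutoff_def by (intro continuous_intros)

lemma cutoff_difference_quotient_le:
  assumes a: "\<And>n. 0 \<le> a n"
  shows "(cutoff E a N M z - cutoff E a N M \<xi>)\<^sup>2 / (cmod (z - \<xi>))\<^sup>2
    \<le> (\<Sum>n=N..<M. \<Sum>m=n..<M. 64 * a n * a m * nbhd_kernel E ((1 / 2) ^ m) ((1 / 2) ^ n) z \<xi>)"
proof (cases "z = \<xi>")
  \<comment> \<open>Division by zero makes the quotient 0 here, so nonnegativity of the right side
    is enough.\<close>
  case True
  then show ?thesis
    using a nbhd_kernel_nonneg by (auto intro!: sum_nonneg mult_nonneg_nonneg)
next
  case False
  define q where "q = dist z \<xi>"
  have q: "0 < q" using False by (simp add: q_def)
  define D where "D = (\<lambda>n. \<bar>bump ((1 / 2) ^ n) (infdist z E) - bump ((1 / 2) ^ n) (infdist \<xi> E)\<bar>)"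
  have "cutoff E a N M z - cutoff E a N M \<xi>
      = (\<Sum>n=N..<M. a n * (bump ((1 / 2) ^ n) (infdist z E) - bump ((1 / 2) ^ n) (infdist \<xi> E)))"
    by (simp add: cutoff_def sum_subtractf algebra_simps)
  also have "\<bar>\<dots>\<bar> \<le> (\<Sum>n=N..<M. a n * D n)"
    by (rule order.trans[OF sum_abs]) (simp add: D_def abs_mult a)
  finally have "(cutoff E a N M z - cutoff E a N M \<xi>)\<^sup>2 \<le> (\<Sum>n=N..<M. a n * D n)\<^sup>2"
    by (rule abs_le_square_iff[THEN iffD1, OF order.trans[OF _ abs_ge_self]])
  also have "\<dots> \<le> 2 * (\<Sum>n=N..<M. \<Sum>m=n..<M. (a n * D n) * (a m * D m))"
    by (rule sum_square_le_triangle) (simp add: a D_def)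
  also have "\<dots> = (\<Sum>n=N..<M. \<Sum>m=n..<M. 2 * ((a n * a m) * (D n * D m)))"
    by (simp add: sum_distrib_left mult_ac)
  also have "\<dots> \<le> (\<Sum>n=N..<M. \<Sum>m=n..<M.
      64 * a n * a m * nbhd_kernel E ((1 / 2) ^ m) ((1 / 2) ^ n) z \<xi> * q\<^sup>2)"
  proof (intro sum_mono)
    fix n m assume "n \<in> {N..<M}" "m \<in> {n..<M}"
    then have nm: "(1 / 2) ^ m \<le> (1 / 2 :: real) ^ n" by (intro power_decreasing) auto
    have "\<bar>infdist z E - infdist \<xi> E\<bar> \<le> q"
      unfolding q_def by (rule infdist_triangle_abs)
    from bump_product_le[OF _ nm this]
    have "D n * D m \<le> 32 * nbhd_kernel E ((1 / 2) ^ m) ((1 / 2) ^ n) z \<xi> * q\<^sup>2"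
      by (simp add: D_def nbhd_kernel_def q_def mult_ac
          split del: split_of_bool del: distrib_left_numeral distrib_right_numeral)
    from mult_left_mono[OF this, of "2 * (a n * a m)"]
    show "2 * ((a n * a m) * (D n * D m))
        \<le> 64 * a n * a m * nbhd_kernel E ((1 / 2) ^ m) ((1 / 2) ^ n) z \<xi> * q\<^sup>2"
      using a by (simp add: mult_ac)
  qed
  also have "\<dots> = (\<Sum>n=N..<M. \<Sum>m=n..<M.
      64 * a n * a m * nbhd_kernel E ((1 / 2) ^ m) ((1 / 2) ^ n) z \<xi>) * q\<^sup>2"
    by (simp add: sum_distrib_right)
  finally show ?thesis
    using q by (simp add: divide_le_eq q_def dist_norm)
qed

lemma nn_integral_circle_double_sum:
  fixes f :: "nat \<Rightarrow> nat \<Rightarrow> complex \<Rightarrow> complex \<Rightarrow> ennreal"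
  assumes f: "\<And>n m. (\<lambda>(z, \<xi>). f n m z \<xi>) \<in> borel_measurable borel"
    and M: "sets M = sets circle_borel" "finite_measure M" and N: "sets N = sets circle_borel"
  shows "(\<integral>\<^sup>+\<xi>. \<integral>\<^sup>+z. (\<Sum>n\<in>I. \<Sum>m\<in>J n. f n m z \<xi>) \<partial>M \<partial>N)
    = (\<Sum>n\<in>I. \<Sum>m\<in>J n. \<integral>\<^sup>+\<xi>. \<integral>\<^sup>+z. f n m z \<xi> \<partial>M \<partial>N)"
proof -
  note inner = measurable_circle_pair_inner(1)[OF f M(1)]
  note outer = measurable_circle_nn_integral[OF f M N]
  show ?thesis
    by (simp add: nn_integral_sum borel_measurable_sum inner outer)
qed

lemma dirichlet_integral_cutoff_le:
  assumes sets: "sets \<mu> = sets circle_borel" and fin: "finite_measure \<mu>"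
    and E: "closed E" "E \<noteq> {}"
    and growth: "\<And>\<zeta> r. \<zeta> \<in> E \<Longrightarrow> 0 < r \<Longrightarrow>
      emeasure \<mu> (unit_circle \<inter> ball \<zeta> r) \<le> ennreal (A * r powr \<alpha>)"
    and A: "0 \<le> A" and \<alpha>: "1 \<le> \<alpha>" "\<alpha> < 2" and a: "\<And>n. 0 \<le> a n"
  shows "dirichlet_integral \<mu> (\<lambda>z. complex_of_real (cutoff E a N M z))
    \<le> ennreal (\<Sum>n=N..<M. \<Sum>m=n..<M. 64 * a n * a m *
        ((4 * A * 2 powr \<alpha> / (1 - 2 powr (\<alpha> - 2)) + 96 * A * 4 powr \<alpha>)
          * ((1 / 2) ^ n) powr (\<alpha> - 2)
          * measure arc_length (circle_nbhd E (2 * (1 / 2) ^ m))))"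
proof -
  let ?u = "cutoff E a N M"
  let ?k = "\<lambda>n m z \<xi>. nbhd_kernel E ((1 / 2) ^ m) ((1 / 2) ^ n) z \<xi>"
  have space: "space \<mu> = unit_circle"
    using sets_eq_imp_space_eq[OF sets] by (simp add: space_restrict_space)
  have um: "?u \<in> borel_measurable borel"
    by (intro borel_measurable_continuous_onI continuous_on_cutoff)
  have km: "(\<lambda>(z, \<xi>). ennreal (64 * a n * a m) * ennreal (?k n m z \<xi>)) \<in> borel_measurable borel" for n m
    using nbhd_kernel_measurable[of "(1 / 2) ^ n" E "(1 / 2) ^ m"]
    by (simp add: case_prod_beta')
  have "dirichlet_integral \<mu> (\<lambda>z. complex_of_real (?u z))
      \<le> (\<integral>\<^sup>+\<xi>. \<integral>\<^sup>+z. (\<Sum>n=N..<M. \<Sum>m=n..<M.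
            ennreal (64 * a n * a m) * ennreal (?k n m z \<xi>)) \<partial>arc_length \<partial>\<mu>)"
    unfolding dirichlet_integral_def
  proof (rule nn_integral_mono)
    fix \<xi> assume "\<xi> \<in> space \<mu>"
    then have \<xi>: "\<xi> \<in> unit_circle" by (simp add: space)
    have "local_dirichlet (\<lambda>z. complex_of_real (?u z)) \<xi>
        = (\<integral>\<^sup>+z. ennreal ((?u z - ?u \<xi>)\<^sup>2 / (cmod (z - \<xi>))\<^sup>2) \<partial>circle_measure)"
      using \<xi> by (subst local_dirichlet_continuous)
        (auto intro!: continuous_on_of_real continuous_on_cutoff simp flip: of_real_diff)
    \<comment> \<open>Passing to arc length drops the normalising factor 1 / (2 pi) <= 1.\<close>
    also have "\<dots> \<le> (\<integral>\<^sup>+z. ennreal ((?u z - ?u \<xi>)\<^sup>2 / (cmod (z - \<xi>))\<^sup>2) \<partial>arc_length)"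
    proof (rule circle_measure_le_arc_length, rule measurable_circle_borel[OF _ refl])
      show "(\<lambda>z. ennreal ((?u z - ?u \<xi>)\<^sup>2 / (cmod (z - \<xi>))\<^sup>2)) \<in> borel_measurable borel"
        using um by measurable
    qed
    also have "\<dots> \<le> (\<integral>\<^sup>+z. (\<Sum>n=N..<M. \<Sum>m=n..<M.
        ennreal (64 * a n * a m) * ennreal (?k n m z \<xi>)) \<partial>arc_length)"
    proof (rule nn_integral_mono)
      fix z
      have "ennreal ((?u z - ?u \<xi>)\<^sup>2 / (cmod (z - \<xi>))\<^sup>2)
          \<le> ennreal (\<Sum>n=N..<M. \<Sum>m=n..<M. 64 * a n * a m * ?k n m z \<xi>)"
        by (intro ennreal_leI cutoff_difference_quotient_le a)
      also have "\<dots> = (\<Sum>n=N..<M. \<Sum>m=n..<M. ennreal (64 * a n * a m) * ennreal (?k n m z \<xi>))"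
        using a nbhd_kernel_nonneg
        by (simp add: sum_nonneg ennreal_mult flip: sum_ennreal)
      finally show "ennreal ((?u z - ?u \<xi>)\<^sup>2 / (cmod (z - \<xi>))\<^sup>2)
          \<le> (\<Sum>n=N..<M. \<Sum>m=n..<M. ennreal (64 * a n * a m) * ennreal (?k n m z \<xi>))" .
    qed
    finally show "local_dirichlet (\<lambda>z. complex_of_real (?u z)) \<xi>
        \<le> (\<integral>\<^sup>+z. (\<Sum>n=N..<M. \<Sum>m=n..<M.
            ennreal (64 * a n * a m) * ennreal (?k n m z \<xi>)) \<partial>arc_length)" .
  qed
  also have "\<dots> = (\<Sum>n=N..<M. \<Sum>m=n..<M.
      \<integral>\<^sup>+\<xi>. \<integral>\<^sup>+z. ennreal (64 * a n * a m) * ennreal (?k n m z \<xi>) \<partial>arc_length \<partial>\<mu>)"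
    by (rule nn_integral_circle_double_sum[OF km sets_arc_length finite_measure_arc_length sets])
  also have "\<dots> = (\<Sum>n=N..<M. \<Sum>m=n..<M.
      ennreal (64 * a n * a m) * (\<integral>\<^sup>+\<xi>. \<integral>\<^sup>+z. ennreal (?k n m z \<xi>) \<partial>arc_length \<partial>\<mu>))"
  proof -
    have m: "(\<lambda>(z, \<xi>). ennreal (?k n m z \<xi>)) \<in> borel_measurable borel" for n m
      by (rule nbhd_kernel_measurable) simp
    note inner = measurable_circle_pair_inner(1)[OF m sets_arc_length]
    note outer = measurable_circle_nn_integral[OF m sets_arc_length finite_measure_arc_length sets]
    show ?thesis
      by (simp add: nn_integral_cmult inner outer)
  qed
  also have "\<dots> \<le> (\<Sum>n=N..<M. \<Sum>m=n..<M. ennreal (64 * a n * a m) *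
        ennreal ((4 * A * 2 powr \<alpha> / (1 - 2 powr (\<alpha> - 2)) + 96 * A * 4 powr \<alpha>)
          * ((1 / 2) ^ n) powr (\<alpha> - 2)
          * measure arc_length (circle_nbhd E (2 * (1 / 2) ^ m))))"
    by (intro sum_mono mult_left_mono nbhd_energy_le[OF sets fin E growth A \<alpha>])
      (auto intro: power_decreasing power_le_one)
  also have "\<dots> = ennreal (\<Sum>n=N..<M. \<Sum>m=n..<M. 64 * a n * a m *
        ((4 * A * 2 powr \<alpha> / (1 - 2 powr (\<alpha> - 2)) + 96 * A * 4 powr \<alpha>)
          * ((1 / 2) ^ n) powr (\<alpha> - 2)
          * measure arc_length (circle_nbhd E (2 * (1 / 2) ^ m))))"
  proof -
    have "0 \<le> 4 * A * 2 powr \<alpha> / (1 - 2 powr (\<alpha> - 2)) + 96 * A * 4 powr \<alpha>"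
      using A \<alpha> powr_less_mono[of "\<alpha> - 2" 0 2] by simp
    then show ?thesis
      using a by (simp add: sum_nonneg ennreal_mult flip: sum_ennreal)
  qed
  finally show ?thesis .
qed

text \<open>A convex combination of the profiles takes values in [0, 1], equals 1 near E and
  vanishes outside the coarsest neighbourhood; the length of that neighbourhood therefore bounds the
  squared L2 norm.\<close>

lemma capacity_le_cutoff:
  assumes sub: "E \<subseteq> unit_circle"
    and a: "\<And>n. 0 \<le> a n" "(\<Sum>n=N..<M. a n) = 1"
    and fin: "dirichlet_integral \<mu> (\<lambda>z. complex_of_real (cutoff E a N M z)) < \<infinity>"
  shows "capacity \<mu> E \<le> emeasure arc_length (circle_nbhd E ((1 / 2) ^ N))
    + dirichlet_integral \<mu> (\<lambda>z. complex_of_real (cutoff E a N M z))"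
proof -
  define u where "u = (\<lambda>z. complex_of_real (cutoff E a N M z))"
  let ?K = "circle_nbhd E ((1 / 2) ^ N)"
  \<comment> \<open>The radius is half of h_M, hence at most half of every scale in the sum, so all
    profiles equal 1 on this open set.\<close>
  define U where "U = unit_circle \<inter> {z. infdist z E < (1 / 2) ^ M / 2}"
  have u01: "0 \<le> cutoff E a N M z" "cutoff E a N M z \<le> 1" for z
  proof -
    show "0 \<le> cutoff E a N M z"
      unfolding cutoff_def using a bump_bounds by (intro sum_nonneg mult_nonneg_nonneg) auto
    have "cutoff E a N M z \<le> (\<Sum>n=N..<M. a n * 1)"
      unfolding cutoff_def using a bump_bounds by (intro sum_mono mult_left_mono) auto
    then show "cutoff E a N M z \<le> 1" using a by simp
  qed
  have u1: "cutoff E a N M z = 1" if "z \<in> U" for z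
  proof -
    have "bump ((1 / 2) ^ n) (infdist z E) = 1" if "n \<in> {N..<M}" for n
    proof (rule bump_eq_1)
      have "infdist z E \<le> (1 / 2) ^ M / 2" using \<open>z \<in> U\<close> by (simp add: U_def)
      also have "\<dots> \<le> (1 / 2) ^ n / 2"
        using that by (intro divide_right_mono power_decreasing) auto
      finally show "infdist z E \<le> (1 / 2) ^ n / 2" .
    qed simp
    then have "cutoff E a N M z = (\<Sum>n=N..<M. a n)"
      unfolding cutoff_def by (intro sum.cong) auto
    then show ?thesis using a by simp
  qed
  have u0: "cutoff E a N M z = 0" if "z \<in> unit_circle" "z \<notin> ?K" for z
    unfolding cutoff_def
  proof (intro sum.neutral ballI)
    fix n assume "n \<in> {N..<M}"
    then have "(1 / 2) ^ n \<le> (1 / 2 :: real) ^ N" by (intro power_decreasing) auto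
    also have "\<dots> \<le> infdist z E" using that by (simp add: circle_nbhd_def)
    finally have "bump ((1 / 2) ^ n) (infdist z E) = 0"
      by (intro bump_eq_0) auto
    then show "a n * bump ((1 / 2) ^ n) (infdist z E) = 0" by simp
  qed
  have um: "u \<in> borel_measurable circle_borel"
    unfolding u_def
    by (intro continuous_measurable_circle[OF _ refl] continuous_on_of_real continuous_on_cutoff)
  have L2: "(\<integral>\<^sup>+z. ennreal ((cmod (u z))\<^sup>2) \<partial>circle_measure) \<le> emeasure arc_length ?K"
  proof -
    have "(\<integral>\<^sup>+z. ennreal ((cmod (u z))\<^sup>2) \<partial>circle_measure) \<le> (\<integral>\<^sup>+z. ennreal ((cmod (u z))\<^sup>2) \<partial>arc_length)"
      by (rule circle_measure_le_arc_length) (use um in measurable)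
    also have "\<dots> \<le> (\<integral>\<^sup>+z. indicator ?K z \<partial>arc_length)"
    proof (rule nn_integral_mono)
      fix z assume "z \<in> space arc_length"
      then show "ennreal ((cmod (u z))\<^sup>2) \<le> indicator ?K z"
        using u01[of z] u0[of z] by (cases "z \<in> ?K") (auto simp: u_def space_arc_length power_le_one)
    qed
    also have "\<dots> = emeasure arc_length ?K"
      by (simp add: circle_nbhd_sets sets_arc_length)
    finally show ?thesis .
  qed
  also have "emeasure arc_length ?K < \<infinity>"
    using finite_measure.emeasure_finite[OF finite_measure_arc_length] by (simp add: less_top)
  finally have L2fin: "(\<integral>\<^sup>+z. ennreal ((cmod (u z))\<^sup>2) \<partial>circle_measure) < \<infinity>" .
  have uL2: "u \<in> L2_circle"
    using L2fin um by (simp add: L2_circle_def measurable_cong_sets[OF sets_circle_measure refl])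
  have norm_fin: "dirichlet_norm_sq \<mu> u < \<infinity>"
    using L2fin fin by (simp add: dirichlet_norm_sq_def u_def)
  have "capacity \<mu> E \<le> open_capacity \<mu> U"
    unfolding capacity_def
  proof (rule Inf_lower, rule CollectI, intro exI conjI)
    show "openin (top_of_set unit_circle) U"
      unfolding U_def by (intro openin_open_Int open_Collect_less continuous_intros)
    show "E \<subseteq> U" using sub by (auto simp: U_def)
  qed simp
  also have "\<dots> \<le> dirichlet_norm_sq \<mu> u"
    unfolding open_capacity_def
    by (rule Inf_lower, rule CollectI, intro exI[of _ u])
      (use uL2 norm_fin u01 u1 in \<open>auto simp: harmonic_dirichlet_space_def u_def\<close>)
  also have "\<dots> \<le> emeasure arc_length ?K + dirichlet_integral \<mu> u"
    unfolding dirichlet_norm_sq_def using L2 by (rule add_right_mono)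
  finally show ?thesis by (simp add: u_def)
qed

section \<open>Divergence of the dyadic series\<close>

text \<open>The weights divide by these lengths. Even when E is null, a neighbourhood contains a
  small arc about a point of E.\<close>

lemma measure_circle_nbhd_pos:
  assumes "E \<subseteq> unit_circle" "E \<noteq> {}" "0 < t"
  shows "0 < measure arc_length (circle_nbhd E t)"
proof -
  obtain \<zeta> where \<zeta>: "\<zeta> \<in> E" using assms by auto
  define r where "r = min t 1"
  have r: "0 < r" "r \<le> 1" "r \<le> t" using assms by (auto simp: r_def)
  have "unit_circle \<inter> ball \<zeta> r \<subseteq> circle_nbhd E t"
  proof
    fix z assume z: "z \<in> unit_circle \<inter> ball \<zeta> r"
    have "infdist z E \<le> t" using infdist_le[OF \<zeta>, of z] z r by (simp add: dist_commute)
    then show "z \<in> circle_nbhd E t" using z by (simp add: circle_nbhd_def)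
  qed
  then have "emeasure arc_length (unit_circle \<inter> ball \<zeta> r) \<le> emeasure arc_length (circle_nbhd E t)"
    by (rule emeasure_mono) (simp add: sets_arc_length circle_nbhd_sets)
  with emeasure_arc_length_ball_ge[OF _ r(1,2), of \<zeta>] \<zeta> assms(1)
  have "ennreal r \<le> emeasure arc_length (circle_nbhd E t)" by (meson order_trans subsetD)
  then have "ennreal r \<le> ennreal (measure arc_length (circle_nbhd E t))"
    by (simp add: finite_measure.emeasure_eq_measure[OF finite_measure_arc_length])
  then show ?thesis
    using r by (subst (asm) ennreal_le_iff) auto
qed

lemma tendsto_measure_circle_nbhd:
  assumes E: "E \<subseteq> unit_circle" "closed E" "E \<noteq> {}" and null: "emeasure arc_length E = 0"
  shows "(\<lambda>n. measure arc_length (circle_nbhd E ((1 / 2) ^ n))) \<longlonglongrightarrow> 0"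
proof -
  have "(\<Inter>n. circle_nbhd E ((1 / 2) ^ n)) = E"
  proof (intro equalityI subsetI)
    fix z assume "z \<in> (\<Inter>n. circle_nbhd E ((1 / 2) ^ n))"
    then have "infdist z E \<le> (1 / 2) ^ n" for n by (auto simp: circle_nbhd_def)
    moreover have "(\<lambda>n. (1 / 2 :: real) ^ n) \<longlonglongrightarrow> 0" by (rule LIMSEQ_power_zero) simp
    ultimately have "infdist z E \<le> 0" by (intro LIMSEQ_le_const) auto
    then have "infdist z E = 0" using infdist_nonneg[of z E] by simp
    then show "z \<in> E" using in_closed_iff_infdist_zero[OF E(2,3)] by simp
  next
    fix z assume "z \<in> E"
    then show "z \<in> (\<Inter>n. circle_nbhd E ((1 / 2) ^ n))"
      using E(1) by (auto simp: circle_nbhd_def)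
  qed
  moreover have "(\<lambda>n. measure arc_length (circle_nbhd E ((1 / 2) ^ n)))
      \<longlonglongrightarrow> measure arc_length (\<Inter>n. circle_nbhd E ((1 / 2) ^ n))"
    by (rule finite_measure.finite_Lim_measure_decseq[OF finite_measure_arc_length])
      (auto simp: sets_arc_length circle_nbhd_sets decseq_def
        intro!: circle_nbhd_mono power_decreasing)
  ultimately show ?thesis
    using null by (simp add: measure_def)
qed

lemma one_divide_antimono_ennreal:
  fixes a b :: ennreal
  assumes "a \<le> b"
  shows "1 / b \<le> 1 / a"
proof -
  have "inverse b \<le> inverse a"
    using assms including ennreal.lifting by transfer (simp add: ereal_inverse_antimono)
  then show ?thesis
    by (simp add: divide_ennreal_def)
qed

text \<open>The intervals (4 h_n, 8 h_n] cover (0, pi]. For t in such an interval t / 2 >= 2 h_n, so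
  the arc neighbourhood contains the chordal one of radius 2 h_n, and the integrand is at most 1 /
  (h_n^(\<alpha> - 1) e_n). The interval has length 4 h_n, so summability would make the integral
  finite.\<close>

lemma not_summable_dyadic:
  assumes E: "E \<subseteq> unit_circle" "closed E" "E \<noteq> {}" and \<alpha>: "1 \<le> \<alpha>"
    and div: "(\<integral>\<^sup>+t\<in>{0<..pi}. 1 / (ennreal (t powr (\<alpha> - 1)) * emeasure arc_length (arc_nbhd E t)) \<partial>lborel) = \<infinity>"
  shows "\<not> summable (\<lambda>n. (2 powr (\<alpha> - 2)) ^ n / measure arc_length (circle_nbhd E (2 * (1 / 2) ^ n)))"
proof
  define h :: "nat \<Rightarrow> real" where "h = (\<lambda>n. (1 / 2) ^ n)"
  define e where "e = (\<lambda>n. measure arc_length (circle_nbhd E (2 * h n)))"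
  define b where "b = (\<lambda>n. (2 powr (\<alpha> - 2)) ^ n / e n)"
  have h: "0 < h n" for n by (simp add: h_def)
  have e: "0 < e n" for n
    unfolding e_def using h by (intro measure_circle_nbhd_pos E) auto
  have b: "0 \<le> b n" for n using e[of n] by (simp add: b_def)
  assume "summable (\<lambda>n. (2 powr (\<alpha> - 2)) ^ n / measure arc_length (circle_nbhd E (2 * (1 / 2) ^ n)))"
  then have "summable b" by (simp add: b_def e_def h_def)
  then have fin: "(\<Sum>n. ennreal (4 * b n)) = ennreal (\<Sum>n. 4 * b n)"
    using b by (intro suminf_ennreal2 summable_mult) auto
  \<comment> \<open>This rests on T^n = h_n^(2 - \<alpha>) = h_n / h_n^(\<alpha> - 1).\<close>
  have hb: "4 * b n = 1 / (h n powr (\<alpha> - 1) * e n) * (4 * h n)" for n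
  proof -
    have "(2 powr (\<alpha> - 2)) ^ n = 2 powr ((\<alpha> - 2) * real n)"
      by (simp add: powr_powr flip: powr_realpow)
    also have "(\<alpha> - 2) * real n = - real n * - (\<alpha> - 2)"
      by (simp only: minus_mult_minus mult.commute)
    also have "2 powr (- real n * - (\<alpha> - 2)) = (2 powr - real n) powr - (\<alpha> - 2)"
      by (simp only: powr_powr)
    also have "2 powr - real n = h n"
      by (simp add: h_def powr_minus powr_realpow power_one_over inverse_eq_divide)
    also have "h n powr - (\<alpha> - 2) = h n powr (1 - (\<alpha> - 1))" by (simp add: algebra_simps)
    also have "\<dots> = h n / h n powr (\<alpha> - 1)"
      using h[of n] by (simp only: powr_diff) simp
    finally show ?thesis using e[of n] by (simp add: b_def)
  qed
  let ?f = "\<lambda>t. 1 / (ennreal (t powr (\<alpha> - 1)) * emeasure arc_length (arc_nbhd E t))"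
  have pointwise: "?f t * indicator {0<..pi} t
      \<le> (\<Sum>n. ennreal (1 / (h n powr (\<alpha> - 1) * e n)) * indicator {4 * h n<..8 * h n} t)" for t
  proof (cases "t \<in> {0<..pi}")
    case True
    then have t: "0 < t" "t \<le> pi" by auto
    have "\<exists>n. 4 * h n < t"
      using real_arch_pow_inv[of "t / 4" "1 / 2"] t by (auto simp: h_def mult.commute)
    define j where "j = (LEAST n. 4 * h n < t)"
    have j: "4 * h j < t" unfolding j_def using \<open>\<exists>n. 4 * h n < t\<close> by (rule LeastI_ex)
    have "t \<le> 8 * h j"
    proof (cases j)
      case 0
      then show ?thesis using t pi_less_4 by (simp add: h_def)
    next
      case (Suc i)
      then have "\<not> 4 * h i < t" using not_less_Least[of i "\<lambda>n. 4 * h n < t"] by (simp add: j_def)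
      then show ?thesis using Suc by (simp add: h_def)
    qed
    have "ennreal (e j) \<le> emeasure arc_length (arc_nbhd E t)"
    proof -
      have "circle_nbhd E (2 * h j) \<subseteq> arc_nbhd E t"
        using circle_nbhd_mono[of "2 * h j" "t / 2" E] circle_nbhd_subset_arc_nbhd[OF E, of t] t j by auto
      moreover have "arc_nbhd E t \<in> sets arc_length"
        using t by (simp add: arc_nbhd_eq[OF E] sets_arc_length circle_nbhd_sets)
      ultimately show ?thesis
        unfolding e_def finite_measure.emeasure_eq_measure[OF finite_measure_arc_length, symmetric]
        by (rule emeasure_mono)
    qed
    moreover have "h j powr (\<alpha> - 1) \<le> t powr (\<alpha> - 1)"
      using h[of j] j \<alpha> by (intro powr_mono2) auto
    ultimately have "ennreal (h j powr (\<alpha> - 1)) * ennreal (e j)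
        \<le> ennreal (t powr (\<alpha> - 1)) * emeasure arc_length (arc_nbhd E t)"
      by (intro mult_mono ennreal_leI) auto
    then have "?f t \<le> 1 / (ennreal (h j powr (\<alpha> - 1)) * ennreal (e j))"
      by (rule one_divide_antimono_ennreal)
    also have "\<dots> = ennreal (1 / (h j powr (\<alpha> - 1) * e j))"
    proof -
      have "0 < h j powr (\<alpha> - 1) * e j" using h[of j] e[of j] by simp
      then show ?thesis
        using e[of j] divide_ennreal[of 1 "h j powr (\<alpha> - 1) * e j"]
        by (simp flip: ennreal_mult)
    qed
    finally have "?f t * indicator {0<..pi} t
        \<le> ennreal (1 / (h j powr (\<alpha> - 1) * e j)) * indicator {4 * h j<..8 * h j} t" (is "_ \<le> ?F j")
      using j \<open>t \<le> 8 * h j\<close> True by simp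
    also have "\<dots> \<le> (\<Sum>n. ?F n)"
    proof -
      define F where "F = ?F"
      have "F j \<le> suminf F"
        using sum_le_suminf[of F "{j}"] by (simp add: summableI)
      then show ?thesis by (simp add: F_def)
    qed
    finally show ?thesis .
  qed simp
  have "(\<integral>\<^sup>+t\<in>{0<..pi}. ?f t \<partial>lborel)
      \<le> (\<integral>\<^sup>+t. (\<Sum>n. ennreal (1 / (h n powr (\<alpha> - 1) * e n)) * indicator {4 * h n<..8 * h n} t) \<partial>lborel)"
    by (intro nn_integral_mono pointwise)
  also have "\<dots> = (\<Sum>n. ennreal (1 / (h n powr (\<alpha> - 1) * e n)) * ennreal (4 * h n))"
    using h by (subst nn_integral_suminf) (auto simp: nn_integral_cmult_indicator less_imp_le)
  also have "\<dots> = (\<Sum>n. ennreal (4 * b n))"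
    unfolding hb using h e by (simp add: less_imp_le flip: ennreal_mult)
  also have "\<dots> < \<infinity>" unfolding fin by simp
  finally show False using div by simp
qed

text \<open>The factor e_m cancels against the weight of index m and leaves T^m. The tail from n on
  is at most T^n / (1 - T), which absorbs 1 / T^n; the remaining sum over n is B again and removes
  one of the two factors 1 / B.\<close>

lemma weighted_energy_sum_le:
  fixes e :: "nat \<Rightarrow> real" and T C :: real
  assumes e: "\<And>n. 0 < e n" and T: "0 < T" "T < 1" and C: "0 \<le> C"
    and B: "B = (\<Sum>n=N..<M. T ^ n / e n)" "0 < B"
  shows "(\<Sum>n=N..<M. \<Sum>m=n..<M. 64 * (T ^ n / e n / B) * (T ^ m / e m / B) * (C * (1 / T ^ n) * e m))
    \<le> 64 * C / (1 - T) / B"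
proof -
  have "(\<Sum>n=N..<M. \<Sum>m=n..<M. 64 * (T ^ n / e n / B) * (T ^ m / e m / B) * (C * (1 / T ^ n) * e m))
      = (\<Sum>n=N..<M. 64 * C / (e n * B\<^sup>2) * (\<Sum>m=n..<M. T ^ m))"
    unfolding sum_distrib_left
  proof (intro sum.cong refl)
    fix n m
    show "64 * (T ^ n / e n / B) * (T ^ m / e m / B) * (C * (1 / T ^ n) * e m)
        = 64 * C / (e n * B\<^sup>2) * T ^ m"
      using e[of n] e[of m] T B(2) by (simp add: field_simps power2_eq_square)
  qed
  also have "\<dots> \<le> (\<Sum>n=N..<M. 64 * C / (e n * B\<^sup>2) * (T ^ n / (1 - T)))"
  proof (intro sum_mono mult_left_mono)
    fix n assume n: "n \<in> {N..<M}"
    have "(\<Sum>m=n..<M. T ^ m) * (1 - T) = (\<Sum>m=n..<M. - (T ^ Suc m) - (- (T ^ m)))"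
      unfolding sum_distrib_right by (intro sum.cong) (simp_all add: right_diff_distrib)
    also have "\<dots> = T ^ n - T ^ M"
      using n sum_Suc_diff'[of n M "\<lambda>i. - (T ^ i)"] by simp
    finally have "(\<Sum>m=n..<M. T ^ m) = (T ^ n - T ^ M) / (1 - T)"
      using T by (subst nonzero_eq_divide_eq) auto
    also have "\<dots> \<le> T ^ n / (1 - T)" using T by (intro divide_right_mono) auto
    finally show "(\<Sum>m=n..<M. T ^ m) \<le> T ^ n / (1 - T)" .
    show "0 \<le> 64 * C / (e n * B\<^sup>2)" using C e[of n] by simp
  qed
  also have "\<dots> = 64 * C / (1 - T) / B\<^sup>2 * (\<Sum>n=N..<M. T ^ n / e n)"
    unfolding sum_distrib_left by (intro sum.cong) (simp_all add: mult_ac)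
  also have "\<dots> = 64 * C / (1 - T) / B"
    using B by (simp add: power2_eq_square)
  finally show ?thesis .
qed

text \<open>The zero function is admissible for the empty open set.\<close>

lemma capacity_empty:
  assumes "sets \<mu> = sets circle_borel"
  shows "capacity \<mu> {} = 0"
proof -
  let ?u = "\<lambda>_::complex. 0 :: complex"
  have "space \<mu> = unit_circle"
    using sets_eq_imp_space_eq[OF assms] by (simp add: space_restrict_space)
  moreover have "local_dirichlet ?u \<xi> = 0" if "\<xi> \<in> unit_circle" for \<xi>
    using that by (subst local_dirichlet_continuous) auto
  ultimately have "dirichlet_integral \<mu> ?u = (\<integral>\<^sup>+\<xi>. 0 \<partial>\<mu>)"
    unfolding dirichlet_integral_def by (intro nn_integral_cong) auto
  then have norm: "dirichlet_norm_sq \<mu> ?u = 0"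
    by (simp add: dirichlet_norm_sq_def)
  have "capacity \<mu> {} \<le> open_capacity \<mu> {}"
    unfolding capacity_def by (rule Inf_lower) auto
  also have "\<dots> \<le> dirichlet_norm_sq \<mu> ?u"
    unfolding open_capacity_def
    by (rule Inf_lower, rule CollectI, intro exI[of _ ?u])
      (auto simp: harmonic_dirichlet_space_def L2_circle_def norm)
  finally show ?thesis by (simp add: norm)
qed

theorem mainTheorem5:
  fixes \<mu> :: "complex measure" and E :: "complex set" and \<alpha> :: real
  assumes "finite_measure \<mu>" and "sets \<mu> = sets circle_borel"
    and "E \<subseteq> unit_circle" and "closed E" and "emeasure arc_length E = 0"
    and "1 \<le> \<alpha>" and "\<alpha> < 2"
    and "(\<lambda>t. enn2real (arc_modulus \<mu> E t)) \<in> O[at_right 0](\<lambda>t. t powr \<alpha>)"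
    and "(\<integral>\<^sup>+t\<in>{0<..pi}. 1 / (ennreal (t powr (\<alpha> - 1)) * emeasure arc_length (arc_nbhd E t)) \<partial>lborel) = \<infinity>"
  shows "capacity \<mu> E = 0"
proof (cases "E = {}")
  case True
  then show ?thesis using capacity_empty[OF assms(2)] by simp
next
  case ne: False
  obtain A where A: "0 \<le> A" and growth: "\<And>\<zeta> r. \<zeta> \<in> E \<Longrightarrow> 0 < r \<Longrightarrow>
      emeasure \<mu> (unit_circle \<inter> ball \<zeta> r) \<le> ennreal (A * r powr \<alpha>)"
    using arc_modulus_growth[OF assms(1,2,3) _ assms(8)] assms(6) by auto
  define T :: real where "T = 2 powr (\<alpha> - 2)"
  define C where "C = 4 * A * 2 powr \<alpha> / (1 - T) + 96 * A * 4 powr \<alpha>"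
  define e where "e = (\<lambda>n::nat. measure arc_length (circle_nbhd E (2 * (1 / 2) ^ n)))"
  define b where "b = (\<lambda>n. T ^ n / e n)"
  have T: "0 < T" "T < 1"
    using assms(7) powr_less_mono[of "\<alpha> - 2" 0 2] by (auto simp: T_def)
  have C: "0 \<le> C" using A T by (simp add: C_def)
  have e: "0 < e n" for n
    unfolding e_def by (intro measure_circle_nbhd_pos assms ne) simp
  have b: "0 < b n" for n using e[of n] T by (simp add: b_def)
  have pow: "((1 / 2) ^ n) powr (\<alpha> - 2) = 1 / T ^ n" for n
  proof -
    have "((1 / 2 :: real) ^ n) powr (\<alpha> - 2) = (1 / 2 ^ n) powr (\<alpha> - 2)"
      by (simp add: power_one_over)
    also have "\<dots> = 1 / (2 powr real n) powr (\<alpha> - 2)"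
      by (simp add: powr_divide powr_realpow)
    also have "(2 powr real n) powr (\<alpha> - 2) = T ^ n"
      by (simp add: T_def powr_powr mult.commute flip: powr_realpow)
    finally show ?thesis .
  qed
  have not_summable: "\<not> summable b"
    using not_summable_dyadic[OF assms(3,4) ne assms(6,9)] by (simp add: b_def e_def T_def)
  have "capacity \<mu> E \<le> ennreal \<epsilon>" if \<epsilon>: "0 < \<epsilon>" for \<epsilon>
  proof -
    \<comment> \<open>N is fixed first and controls the L2 norm; M is chosen afterwards to control
      the energy. This works because every tail of the series still diverges.\<close>
    have "eventually (\<lambda>N. measure arc_length (circle_nbhd E ((1 / 2) ^ N)) < \<epsilon> / 2) sequentially"
      using tendsto_measure_circle_nbhd[OF assms(3,4) ne assms(5)] \<epsilon> by (intro order_tendstoD(2)) auto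
    then obtain N where N: "measure arc_length (circle_nbhd E ((1 / 2) ^ N)) < \<epsilon> / 2"
      by (auto simp: eventually_sequentially)
    define X where "X = 64 * C / (1 - T)"
    \<comment> \<open>The threshold is the value of B at which the energy bound X / B equals
      \<epsilon> / 2.\<close>
    define R where "R = X / (\<epsilon> / 2)"
    have R: "0 \<le> R" using C T \<epsilon> by (simp add: R_def X_def)
    have "\<exists>k. (\<Sum>i<k. b (i + N)) > R"
    proof (rule ccontr)
      assume "\<not> (\<exists>k. (\<Sum>i<k. b (i + N)) > R)"
      then have "summable (\<lambda>i. b (i + N))"
        using b by (intro summableI_nonneg_bounded[of _ R]) (auto simp: less_imp_le not_less)
      then show False using not_summable by (simp add: summable_iff_shift)
    qed
    then obtain k where k: "(\<Sum>i<k. b (i + N)) > R" ..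
    define M where "M = k + N"
    define B where "B = (\<Sum>n=N..<M. b n)"
    have "B = (\<Sum>i<k. b (i + N))"
      using sum.shift_bounds_nat_ivl[of b 0 N k]
      by (simp add: B_def M_def atLeast0LessThan)
    then have BR: "R < B" using k by simp
    have B: "0 < B" using BR R by simp
    define a where "a = (\<lambda>n. b n / B)"
    have a: "0 \<le> a n" for n using b[of n] B by (simp add: a_def less_imp_le)
    have a1: "(\<Sum>n=N..<M. a n) = 1"
      using B by (simp add: a_def B_def flip: sum_divide_distrib)
    let ?u = "\<lambda>z. complex_of_real (cutoff E a N M z)"
    have "dirichlet_integral \<mu> ?u \<le> ennreal (\<Sum>n=N..<M. \<Sum>m=n..<M.
        64 * (T ^ n / e n / B) * (T ^ m / e m / B) * (C * (1 / T ^ n) * e m))"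
      using dirichlet_integral_cutoff_le[OF assms(2,1,4) ne growth A assms(6,7), of a N M] a
      by (simp add: pow C_def T_def e_def a_def b_def)
    also have "\<dots> \<le> ennreal (64 * C / (1 - T) / B)"
      by (intro ennreal_leI weighted_energy_sum_le e T C B) (simp add: B_def b_def)
    also have "\<dots> \<le> ennreal (\<epsilon> / 2)"
    proof (rule ennreal_leI)
      have "X = R * (\<epsilon> / 2)" using \<epsilon> by (simp add: R_def)
      also have "\<dots> \<le> B * (\<epsilon> / 2)" using BR \<epsilon> by (intro mult_right_mono) auto
      finally have "X / B \<le> \<epsilon> / 2" using B by (simp only: pos_divide_le_eq mult.commute)
      then show "64 * C / (1 - T) / B \<le> \<epsilon> / 2" by (simp only: X_def)
    qed
    finally have D: "dirichlet_integral \<mu> ?u \<le> ennreal (\<epsilon> / 2)" .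
    have "dirichlet_integral \<mu> ?u < \<infinity>"
      using D by (rule le_less_trans) simp
    from capacity_le_cutoff[OF assms(3) a a1 this]
    have "capacity \<mu> E \<le> ennreal (measure arc_length (circle_nbhd E ((1 / 2) ^ N)))
        + dirichlet_integral \<mu> ?u"
      by (simp add: finite_measure.emeasure_eq_measure[OF finite_measure_arc_length])
    also have "\<dots> \<le> ennreal (\<epsilon> / 2) + ennreal (\<epsilon> / 2)"
      using N D by (intro add_mono ennreal_leI) auto
    also have "\<dots> = ennreal \<epsilon>"
      using \<epsilon> by (simp flip: ennreal_plus)
    finally show ?thesis .
  qed
  then have "capacity \<mu> E \<le> 0"
    by - (rule ennreal_le_epsilon, simp)
  then show ?thesis by simp
qed

end
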